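(* Let $X\sim\mathrm{VG}(\nu,\alpha,\beta,\mu)$, where $\nu>-1/2$, $0\le|\beta|<\alpha$, $\mu\in\mathbb{R}$. Let $r\ge1$ be an odd integer. Then, as $\alpha\mu\to0$, $$\begin{aligned} \mathbb{E}[|X|^r]&=\frac{2^r(1-\beta^2/\alpha^2)^{\nu+1/2}}{\sqrt{\pi}\alpha^{r}\Gamma(\nu+1/2)}\bigg\{\sum_{k=0}^{(r-1)/2}\Big(\frac{\alpha\mu}{2}\Big)^{2k}\Gamma\Big(\frac{r-2k+1}{2}\Big)\Gamma\Big(\nu+\frac{r-2k+1}{2}\Big)\\ &\quad\times\bigg[\binom{r}{2k}\,{}_2F_1\Big(\frac{r-2k+1}{2},\nu+\frac{r-2k+1}{2};\frac12;\frac{\beta^2}{\alpha^2}\Big)\\ &\quad+\frac{\beta}{\alpha}(\alpha\mu)\binom{r}{2k+1}\,{}_2F_1\Big(\frac{r-2k+1}{2},\nu+\frac{r-2k+1}{2};\frac32;\frac{\beta^2}{\alpha^2}\Big)\bigg]+R_{\nu,\alpha,\beta,r}(\alpha|\mu|)\bigg\}, \end{aligned}$$ where, for $u=\alpha|\mu|$, $$R_{\nu,\alpha,\beta,r}(u)=\begin{cases}(r+1)^{-1}\Gamma(\nu)\,u^{r+1}+o(u^{r+1}), & \nu>0,\\ -2(r+1)^{-1}u^{r+1}\log(u)+O(u^{r+1}), & \nu=0,\\ 2^{-2\nu}\,\Gamma(-\nu)\,B(r+1,2\nu+1)\,u^{r+1+2\nu}+O(u^{r+1}), & \nu\in(-\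tfrac12,0).\end{cases}$$
   Context: $\mathrm{VG}(\nu,\alpha,\beta,\mu)$ denotes the variance-gamma distribution, with probability density function on $\mathbb{R}$ $$p(x)=\frac{(\alpha^2-\beta^2)^{\nu+1/2}}{\sqrt{\pi}(2\alpha)^\nu\Gamma(\nu+1/2)}\,\mathrm{e}^{\beta(x-\mu)}|x-\mu|^\nu K_\nu(\alpha|x-\mu|),$$ where $K_\nu$ is the modified Bessel function of the second kind. ${}_2F_1$ is the Gauss hypergeometric function and $B$ is the beta function.
   Formalization: The remainder enters the braces as R/2^r instead of R (the printed formula fails, e.g. for ν=1/2, α=1, β=0, r=1), and R is a function of αμ rather than α|μ|, since for β≠0 it depends on the sign of μ; its asymptotics in u=α|μ| are as printed. *)

theory Defs
  imports "HOL-Probability.Probability"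
begin

text \<open>Meaningful for \<open>x > 0\<close>, where the integral converges for every real order.\<close>

definition bessel_K :: "real \<Rightarrow> real \<Rightarrow> real" where
  "bessel_K \<nu> x = (LBINT t:{0..}. exp (- x * cosh t) * cosh (\<nu> * t))"

text \<open>The Gauss series; it is used only for \<open>\<bar>z\<bar> < 1\<close>.\<close>

definition hyp2F1 :: "real \<Rightarrow> real \<Rightarrow> real \<Rightarrow> real \<Rightarrow> real" where
  "hyp2F1 a b c z = eval_fps (fps_hypergeo [a, b] [c] 1) z"

text \<open>The value at the single point \<open>x = \<mu>\<close> is irrelevant to the distribution.\<close>

definition vg_density :: "real \<Rightarrow> real \<Rightarrow> real \<Rightarrow> real \<Rightarrow> real \<Rightarrow> real" where
  "vg_density \<nu> \<alpha> \<beta> \<mu> x =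
     (\<alpha>\<^sup>2 - \<beta>\<^sup>2) powr (\<nu> + 1/2) / (sqrt pi * (2 * \<alpha>) powr \<nu> * Gamma (\<nu> + 1/2)) *
     exp (\<beta> * (x - \<mu>)) * \<bar>x - \<mu>\<bar> powr \<nu> * bessel_K \<nu> (\<alpha> * \<bar>x - \<mu>\<bar>)"

text \<open>
  On the expansion of the absolute moments of odd order \<open>r\<close>: the remainder \<open>R\<close> enters the braces
  as \<open>R / 2 ^ r\<close>. The published formula has \<open>R\<close> there without this factor, which is an error: for
  \<open>\<nu> = 1/2\<close>, \<open>\<alpha> = 1\<close>, \<open>\<beta> = 0\<close>, \<open>r = 1\<close> (Laplace distribution) the moment is
  \<open>\<bar>\<mu>\<bar> + exp (- \<bar>\<mu>\<bar>) = 1 + \<mu>\<^sup>2 / 2 + o(\<mu>\<^sup>2)\<close>, whereas the published formula gives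
  \<open>1 + \<mu>\<^sup>2 + o(\<mu>\<^sup>2)\<close>. Moreover \<open>R\<close> is a function of \<open>\<alpha> * \<mu>\<close>
  rather than of \<open>\<alpha> * \<bar>\<mu>\<bar>\<close>, because for \<open>\<beta> \<noteq> 0\<close> the exact remainder depends on the sign of \<open>\<mu>\<close>;
  its asymptotic form depends on \<open>\<alpha> * \<bar>\<mu>\<bar>\<close> only.
\<close>

end

theory Submission
  imports Defs
begin

text \<open>
  Write \<open>b = \<beta> / \<alpha>\<close>, \<open>u = \<alpha> * \<mu>\<close>, \<open>s = \<alpha> * (x - \<mu>)\<close> and \<open>G(s) = s powr \<nu> * K\<^sub>\<nu>(s)\<close>. Up to constants the
  moment is the integral of \<open>\<bar>u + s\<bar> ^ r * exp (b * s) * G(\<bar>s\<bar>)\<close>. Since \<open>r\<close> is odd,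
  \<open>\<bar>u + s\<bar> ^ r = sgn (u + s) * (u + s) ^ r\<close>. Replacing \<open>sgn (u + s)\<close> by \<open>sgn s\<close> gives a polynomial
  in \<open>u\<close>, whose coefficients are integrals over \<open>s > 0\<close> of odd powers times \<open>cosh (b * s) * G(s)\<close> and
  of even powers times \<open>sinh (b * s) * G(s)\<close>; expanding in powers of \<open>b\<close> yields the hypergeometric
  terms. The error of the replacement lives on \<open>\<bar>s\<bar> < \<bar>u\<bar>\<close> and is the remainder, whose
  asymptotics follow from those of \<open>G\<close> at \<open>0\<close>.

  Everything about \<open>G\<close> is read off from
  \<open>2 powr (1 - \<nu>) * G(y) = \<integral>\<^sub>0\<^sup>\<infinity> v powr (\<nu> - 1) * exp (- v - y\<^sup>2 / (4 * v)) dv\<close>: by Tonelli its moments are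
  Gamma integrals of Gaussian moments, and near \<open>0\<close> one drops the factor \<open>exp (- y\<^sup>2 / (4 * v))\<close> if
  \<open>\<nu> > 0\<close> and the factor \<open>exp (- v)\<close> if \<open>\<nu> < 0\<close>.
\<close>

section \<open>Substitutions on the half line\<close>

text \<open>Oddness of \<open>r\<close> makes the coefficients explicit: after folding
  \<open>s\<close> and \<open>- s\<close> together, odd powers meet cosh and even powers meet sinh,
  so only moments of G of odd order occur, and these are factorials times Gamma values. Integrals
  are first evaluated as extended nonnegative integrals, where Tonelli asks for no integrability,
  and only then read as Bochner integrals. This matters already for \<open>bessel_K\<close>, a
  Bochner integral whose value would default to 0 if it diverged. The bound \<nu> > -1/2 serves both
  for the integrability of G, which is of order \<open>s powr (2 * \<nu>)\<close> at 0 for negative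
  \<nu>, and for the remainder: there \<open>exp (b * s)\<close> differs from 1 by O(s), and
  multiplied by the leading term of G this error stays bounded for \<nu> \<le> 0 because
  \<open>s * ln s\<close> and \<open>s powr (1 + 2 * \<nu>)\<close> do. The sign of \<mu> is felt
  only through this exponential, hence not in the leading terms.\<close>

lemma nn_integral_exp_substitution:
  fixes f :: "real \<Rightarrow> real"
  assumes [measurable]: "f \<in> borel_measurable borel"
  shows "(\<integral>\<^sup>+v. ennreal (indicator {0<..} v * f v) \<partial>lborel)
       = (\<integral>\<^sup>+t. ennreal (f (exp t) * exp t) \<partial>lborel)"
proof -
  \<comment> \<open>The substitution rule is applied on compact intervals. The sets
    \<open>J n = exp (I n)\<close> exhaust the half line, and monotone convergence passes to the
    limit. Negative values of \<open>f\<close> become 0 under \<open>ennreal\<close> on both sides,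
    since \<open>exp t > 0\<close>.\<close>
  define I where "I = (\<lambda>n::nat. {- real n..real n})"
  define J where "J = (\<lambda>n::nat. {exp (- real n)..exp (real n)})"
  have step: "(\<integral>\<^sup>+v. ennreal (f v * indicator (J n) v) \<partial>lborel)
            = (\<integral>\<^sup>+t. ennreal (f (exp t) * exp t * indicator (I n) t) \<partial>lborel)" for n
    unfolding I_def J_def
    by (rule nn_integral_substitution)
       (auto simp: set_borel_measurable_def intro!: derivative_eq_intros continuous_intros)
  have SUP_ind: "(SUP n. ennreal (a * indicator (S n) x)) = ennreal (a * indicator T x)"
    if inc: "incseq S" and un: "(\<Union>n. S n) = T" for a x :: real and S :: "nat \<Rightarrow> real set" and T
  proof (cases "x \<in> T")
    case True
    then obtain n where n: "x \<in> S n" unfolding un[symmetric] by blast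
    show ?thesis
    proof (rule antisym)
      show "(SUP n. ennreal (a * indicator (S n) x)) \<le> ennreal (a * indicator T x)"
        using un by (intro SUP_least) (auto simp: indicator_def)
      show "ennreal (a * indicator T x) \<le> (SUP n. ennreal (a * indicator (S n) x))"
        using n True by (intro SUP_upper2[of n]) auto
    qed
  next
    case False
    then have "x \<notin> S n" for n unfolding un[symmetric] by blast
    then show ?thesis using False by simp
  qed
  have incI: "incseq I" "(\<Union>n. I n) = UNIV"
  proof -
    show "incseq I" by (auto simp: I_def incseq_def)
    have "\<exists>n. x \<in> I n" for x
    proof -
      obtain n where "\<bar>x\<bar> \<le> real n" using real_arch_simple by blast
      then show ?thesis by (auto simp: I_def abs_le_iff intro!: exI[of _ n])
    qed
    then show "(\<Union>n. I n) = UNIV" by auto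
  qed
  have incJ: "incseq J" "(\<Union>n. J n) = {0<..}"
  proof -
    have J: "x \<in> J n \<longleftrightarrow> x > 0 \<and> ln x \<in> I n" for x n
      unfolding I_def J_def
      by (auto simp: ln_ge_iff intro: less_le_trans[OF exp_gt_zero])
         (metis exp_le_cancel_iff exp_ln exp_gt_zero less_le_trans)+
    show "incseq J" using incI(1) by (fastforce simp: incseq_def J)
    show "(\<Union>n. J n) = {0<..}" using incI(2) by (auto simp: J set_eq_iff)
  qed
  have mono: "incseq (\<lambda>n x. ennreal (g x * indicator (S n) x))"
    if "incseq S" for g :: "real \<Rightarrow> real" and S
    using that by (auto simp: incseq_def le_fun_def indicator_def)
  have meas[measurable]: "I n \<in> sets borel" "J n \<in> sets borel" for n by (auto simp: I_def J_def)
  have "(\<integral>\<^sup>+v. ennreal (indicator {0<..} v * f v) \<partial>lborel)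
      = (\<integral>\<^sup>+v. (SUP n. ennreal (f v * indicator (J n) v)) \<partial>lborel)"
    by (subst SUP_ind[OF incJ]) (simp add: mult.commute)
  also have "\<dots> = (SUP n. \<integral>\<^sup>+v. ennreal (f v * indicator (J n) v) \<partial>lborel)"
    by (rule nn_integral_monotone_convergence_SUP) (use mono incJ in auto)
  also have "\<dots> = (SUP n. \<integral>\<^sup>+t. ennreal (f (exp t) * exp t * indicator (I n) t) \<partial>lborel)"
    by (simp add: step)
  also have "\<dots> = (\<integral>\<^sup>+t. (SUP n. ennreal (f (exp t) * exp t * indicator (I n) t)) \<partial>lborel)"
    by (rule nn_integral_monotone_convergence_SUP[symmetric])
       (use mono[of I "\<lambda>t. f (exp t) * exp t"] incI in auto)
  also have "\<dots> = (\<integral>\<^sup>+t. ennreal (f (exp t) * exp t) \<partial>lborel)"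
    by (subst SUP_ind[OF incI]) simp
  finally show ?thesis .
qed

text \<open>In the coordinate \<open>v = exp t\<close> inversion is the reflection of
  \<open>t\<close>, which preserves \<open>lborel\<close>.\<close>

lemma nn_integral_inverse_substitution:
  fixes f :: "real \<Rightarrow> real"
  assumes [measurable]: "f \<in> borel_measurable borel"
  shows "(\<integral>\<^sup>+v. ennreal (indicator {0<..} v * (f (1 / v) / v\<^sup>2)) \<partial>lborel)
       = (\<integral>\<^sup>+v. ennreal (indicator {0<..} v * f v) \<partial>lborel)"
proof -
  have "(\<integral>\<^sup>+v. ennreal (indicator {0<..} v * (f (1 / v) / v\<^sup>2)) \<partial>lborel)
      = (\<integral>\<^sup>+t. ennreal (f (exp (- t)) * exp (- t)) \<partial>lborel)"
    by (subst nn_integral_exp_substitution)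
       (auto simp: exp_minus field_simps power2_eq_square)
  also have "\<dots> = (\<integral>\<^sup>+t. ennreal (f (exp t) * exp t) \<partial>lborel)"
    by (subst nn_integral_real_affine[where c = "-1" and t = 0]) auto
  finally show ?thesis by (simp add: nn_integral_exp_substitution)
qed

lemma nn_integral_scale_substitution:
  fixes f :: "real \<Rightarrow> real"
  assumes [measurable]: "f \<in> borel_measurable borel" and c: "c > 0"
  shows "(\<integral>\<^sup>+v. ennreal (indicator {0<..} v * (f (c * v) * c)) \<partial>lborel)
       = (\<integral>\<^sup>+v. ennreal (indicator {0<..} v * f v) \<partial>lborel)"
proof -
  have "(\<integral>\<^sup>+v. ennreal (indicator {0<..} v * f v) \<partial>lborel)
     = (\<integral>\<^sup>+v. ennreal c * ennreal (indicator {0<..} (c * v) * f (c * v)) \<partial>lborel)"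
    using c by (subst nn_integral_real_affine[where c = c and t = 0]) (auto simp: nn_integral_cmult)
  also have "\<dots> = (\<integral>\<^sup>+v. ennreal (indicator {0<..} v * (f (c * v) * c)) \<partial>lborel)"
    using c by (intro nn_integral_cong)
       (auto simp: ennreal_mult'[symmetric] indicator_def zero_less_mult_iff mult_ac)
  finally show ?thesis by simp
qed

lemma nn_integral_Gamma_scaled:
  fixes s c :: real
  assumes s: "s > 0" and c: "c > 0"
  shows "(\<integral>\<^sup>+v. ennreal (indicator {0<..} v * (v powr (s - 1) * exp (- c * v))) \<partial>lborel)
       = ennreal (Gamma s / c powr s)"
proof -
  let ?f = "\<lambda>v. v powr (s - 1) * exp (- v)"
  have "ennreal (Gamma s) = (\<integral>\<^sup>+v. ennreal (indicator {0<..} v * ?f v) \<partial>lborel)"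
    unfolding Gamma_conv_nn_integral_real[OF s]
    by (intro nn_integral_cong_AE AE_I[where N = "{0}"])
       (auto simp: indicator_def exp_minus field_simps)
  also have "\<dots> = (\<integral>\<^sup>+v. ennreal (indicator {0<..} v * (?f (c * v) * c)) \<partial>lborel)"
    using c by (subst nn_integral_scale_substitution) auto
  also have "\<dots> = (\<integral>\<^sup>+v. ennreal (c powr s) *
      ennreal (indicator {0<..} v * (v powr (s - 1) * exp (- c * v))) \<partial>lborel)"
    using c by (intro nn_integral_cong)
      (auto simp: ennreal_mult'[symmetric] indicator_def powr_mult powr_diff field_simps)
  also have "\<dots> = ennreal (c powr s) *
      (\<integral>\<^sup>+v. ennreal (indicator {0<..} v * (v powr (s - 1) * exp (- c * v))) \<partial>lborel)"
    by (rule nn_integral_cmult) measurable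
  \<comment> \<open>Extended reals do not cancel freely, so the equation is multiplied by the finite
    inverse of \<open>c powr s\<close> instead of being divided.\<close>
  finally have "ennreal (Gamma s) * ennreal (1 / c powr s) = 
      (\<integral>\<^sup>+v. ennreal (indicator {0<..} v * (v powr (s - 1) * exp (- c * v))) \<partial>lborel)
      * (ennreal (c powr s) * ennreal (1 / c powr s))"
    by (simp add: mult_ac)
  moreover have "ennreal (c powr s) * ennreal (1 / c powr s) = 1"
    using c by (subst ennreal_mult'[symmetric]) auto
  moreover have "ennreal (Gamma s) * ennreal (1 / c powr s) = ennreal (Gamma s / c powr s)"
    using s by (subst ennreal_mult'[symmetric]) auto
  ultimately show ?thesis by simp
qed

section \<open>The Bessel function with its power weight\<close>

definition bessel_G :: "real \<Rightarrow> real \<Rightarrow> real" where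
  "bessel_G \<nu> y = y powr \<nu> * bessel_K \<nu> y"

lemma bessel_K_nonneg: "bessel_K \<nu> y \<ge> 0"
  unfolding bessel_K_def set_lebesgue_integral_def by (intro integral_nonneg_AE) (auto simp: cosh_real_nonneg)

lemma bessel_G_nonneg: "bessel_G \<nu> y \<ge> 0"
  by (simp add: bessel_G_def bessel_K_nonneg)

lemma borel_measurable_cosh_real[measurable]: "(cosh :: real \<Rightarrow> real) \<in> borel_measurable borel"
  by (intro borel_measurable_continuous_onI continuous_intros)

lemma borel_measurable_bessel_K[measurable]: "bessel_K \<nu> \<in> borel_measurable borel"
  unfolding bessel_K_def[abs_def] set_lebesgue_integral_def by measurable

lemma borel_measurable_bessel_G[measurable]: "bessel_G \<nu> \<in> borel_measurable borel"
  unfolding bessel_G_def[abs_def] by measurable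

section \<open>The Bessel function and its moments\<close>

text \<open>The substitution \<open>v = y / 2 * exp t\<close> symmetrises
  \<open>v + y\<^sup>2 / (4 * v)\<close> into \<open>y * cosh t\<close> and turns
  \<open>v powr (\<nu> - 1) dv\<close> into a multiple of \<open>exp (\<nu> * t) dt\<close>. Folding
  negative \<open>t\<close> onto positive \<open>t\<close> then replaces
  \<open>exp (\<nu> * t)\<close> by \<open>2 * cosh (\<nu> * t)\<close>.\<close>

lemma bessel_G_integral_representation:
  assumes \<nu>: "\<nu> > -1" and y: "y > 0"
  shows "(\<integral>\<^sup>+v. ennreal (indicator {0<..} v * (v powr (\<nu> - 1) * exp (- v - y\<^sup>2 / (4 * v)))) \<partial>lborel)
       = ennreal (2 powr (1 - \<nu>) * bessel_G \<nu> y)"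
proof -
  define f where "f = (\<lambda>v. v powr (\<nu> - 1) * exp (- v - y\<^sup>2 / (4 * v)))"
  define h where "h = (\<lambda>t. exp (- y * cosh t) * exp (\<nu> * t))"
  define K where "K = (\<integral>\<^sup>+t. ennreal (indicator {0..} t * (exp (- y * cosh t) * cosh (\<nu> * t))) \<partial>lborel)"
  have [measurable]: "f \<in> borel_measurable borel" "h \<in> borel_measurable borel"
    unfolding f_def h_def by measurable
  \<comment> \<open>Finiteness: \<open>exp (- x) \<le> 1 / x\<close> at
    \<open>x = y\<^sup>2 / (4 * v)\<close> gains a factor \<open>v\<close>, and what remains is the
    convergent integral of \<open>Gamma (\<nu> + 1)\<close>.\<close>
  have gam: "(\<integral>\<^sup>+v. ennreal (indicator {0<..} v * (v powr ((\<nu> + 1) - 1) * exp (- 1 * v))) \<partial>lborel)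
      = ennreal (Gamma (\<nu> + 1) / 1 powr (\<nu> + 1))"
    by (rule nn_integral_Gamma_scaled) (use \<nu> in simp_all)
  have "(\<integral>\<^sup>+v. ennreal (indicator {0<..} v * f v) \<partial>lborel)
      \<le> (\<integral>\<^sup>+v. ennreal (4 / y\<^sup>2) * ennreal (indicator {0<..} v * (v powr ((\<nu> + 1) - 1) * exp (- 1 * v))) \<partial>lborel)"
  proof (rule nn_integral_mono)
    fix v :: real
    have "v powr (\<nu> - 1) * exp (- v - y\<^sup>2 / (4 * v)) \<le> 4 / y\<^sup>2 * (v powr \<nu> * exp (- v))" if "v > 0"
    proof -
      have "y\<^sup>2 / (4 * v) \<le> exp (y\<^sup>2 / (4 * v))"
        using exp_ge_add_one_self[of "y\<^sup>2 / (4 * v)"] by linarith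
      then have "exp (- (y\<^sup>2 / (4 * v))) \<le> 4 * v / y\<^sup>2"
        using that y by (simp add: exp_minus field_simps)
      then have "v powr (\<nu> - 1) * exp (- v) * exp (- (y\<^sup>2 / (4 * v)))
               \<le> v powr (\<nu> - 1) * exp (- v) * (4 * v / y\<^sup>2)"
        by (intro mult_left_mono) auto
      also have "\<dots> = 4 / y\<^sup>2 * (v powr \<nu> * exp (- v))"
        using that by (simp add: powr_diff)
      finally show ?thesis by (simp only: diff_conv_add_uminus exp_add mult.assoc)
    qed
    then show "ennreal (indicator {0<..} v * f v) \<le>
        ennreal (4 / y\<^sup>2) * ennreal (indicator {0<..} v * (v powr ((\<nu> + 1) - 1) * exp (- 1 * v)))"
      by (auto simp: ennreal_mult'[symmetric] indicator_def f_def intro!: ennreal_leI)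
  qed
  also have "\<dots> = ennreal (4 / y\<^sup>2) * ennreal (Gamma (\<nu> + 1) / 1 powr (\<nu> + 1))"
    unfolding gam[symmetric] by (rule nn_integral_cmult) measurable
  also have "\<dots> < \<infinity>" by (simp add: ennreal_mult_less_top)
  finally have fin: "(\<integral>\<^sup>+v. ennreal (indicator {0<..} v * f v) \<partial>lborel) < \<infinity>" .
  have "(\<integral>\<^sup>+v. ennreal (indicator {0<..} v * f v) \<partial>lborel)
      = (\<integral>\<^sup>+t. ennreal (f (exp (ln (y / 2) + t)) * exp (ln (y / 2) + t)) \<partial>lborel)"
    by (subst nn_integral_exp_substitution, measurable)
       (subst nn_integral_real_affine[where c = 1 and t = "ln (y / 2)"], auto)
  also have "\<dots> = (\<integral>\<^sup>+t. ennreal ((y / 2) powr \<nu>) * ennreal (h t) \<partial>lborel)"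
  proof (rule nn_integral_cong)
    fix t :: real
    define v where "v = y / 2 * exp t"
    have v: "v > 0" using y by (simp add: v_def)
    have "f v * v = v powr \<nu> * exp (- v - y\<^sup>2 / (4 * v))"
      using v by (simp add: f_def powr_diff)
    also have "v powr \<nu> = (y / 2) powr \<nu> * exp (\<nu> * t)"
      using y by (simp add: v_def powr_mult powr_divide exp_powr_real mult.commute)
    also have "- v - y\<^sup>2 / (4 * v) = - y * cosh t"
      using y by (simp add: v_def cosh_def exp_minus field_simps power2_eq_square)
    finally have "f v * v = (y / 2) powr \<nu> * h t" by (simp add: h_def)
    then show "ennreal (f (exp (ln (y / 2) + t)) * exp (ln (y / 2) + t)) 
             = ennreal ((y / 2) powr \<nu>) * ennreal (h t)"
      using y by (simp add: exp_add v_def ennreal_mult'[symmetric])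
  qed
  also have "\<dots> = ennreal ((y / 2) powr \<nu>) * (\<integral>\<^sup>+t. ennreal (h t) \<partial>lborel)"
    by (rule nn_integral_cmult) measurable
  also have "(\<integral>\<^sup>+t. ennreal (h t) \<partial>lborel) = 2 * K"
  proof -
    have "(\<integral>\<^sup>+t. ennreal (h t) \<partial>lborel) = 
       (\<integral>\<^sup>+t. ennreal (indicator {0..} t * h t) + ennreal (indicator {..<0} t * h t) \<partial>lborel)"
      by (intro nn_integral_cong) (auto simp: indicator_def)
    also have "\<dots> = (\<integral>\<^sup>+t. ennreal (indicator {0..} t * h t) \<partial>lborel) + (\<integral>\<^sup>+t. ennreal (indicator {..<0} t * h t) \<partial>lborel)"
      by (rule nn_integral_add) measurable
    also have "(\<integral>\<^sup>+t. ennreal (indicator {..<0} t * h t) \<partial>lborel) = (\<integral>\<^sup>+t. ennreal (indicator {..<0} (-t) * h (-t)) \<partial>lborel)"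
      by (subst nn_integral_real_affine[where c = "-1" and t = 0]) auto
    also have "\<dots> = (\<integral>\<^sup>+t. ennreal (indicator {0..} t * h (-t)) \<partial>lborel)"
      by (intro nn_integral_cong_AE AE_I[where N = "{0}"]) (auto simp: indicator_def)
    also have "(\<integral>\<^sup>+t. ennreal (indicator {0..} t * h t) \<partial>lborel) + \<dots> = 
      (\<integral>\<^sup>+t. ennreal (indicator {0..} t * h t) + ennreal (indicator {0..} t * h (-t)) \<partial>lborel)"
      by (rule nn_integral_add[symmetric]) measurable
    also have "\<dots> = (\<integral>\<^sup>+t. ennreal 2 * ennreal (indicator {0..} t * (exp (- y * cosh t) * cosh (\<nu> * t))) \<partial>lborel)"
    proof (intro nn_integral_cong)
      fix t
      have "h t + h (-t) = 2 * (exp (- y * cosh t) * cosh (\<nu> * t))"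
        by (simp add: h_def cosh_field_def[of "\<nu> * t"] algebra_simps)
      moreover have "h t \<ge> 0" "h (-t) \<ge> 0" by (auto simp: h_def)
      ultimately show "ennreal (indicator {0..} t * h t) + ennreal (indicator {0..} t * h (-t)) =
          ennreal 2 * ennreal (indicator {0..} t * (exp (- y * cosh t) * cosh (\<nu> * t)))"
        by (cases "t \<ge> 0") (simp_all only: indicator_simps atLeast_iff mult_1 mult_zero_left
              ennreal_plus[symmetric] ennreal_mult'[symmetric] zero_le_numeral ennreal_0 mult_zero_right
              add_0_right simp_thms)
    qed
    also have "\<dots> = 2 * K" unfolding K_def by (subst nn_integral_cmult) auto
    finally show ?thesis .
  qed
  finally have eq: "(\<integral>\<^sup>+v. ennreal (indicator {0<..} v * f v) \<partial>lborel) = ennreal ((y / 2) powr \<nu>) * (2 * K)" .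
  \<comment> \<open>Here finiteness is used: it excludes the default value 0 that
    \<open>enn2real\<close> and the Bochner integral in \<open>bessel_K\<close> would take at
    infinity.\<close>
  have "ennreal ((y / 2) powr \<nu>) * (2 * K) \<noteq> top" using fin unfolding eq by simp
  then have "K \<noteq> top" using y by (auto simp: ennreal_mult_eq_top_iff)
  have "bessel_K \<nu> y = enn2real K"
    unfolding bessel_K_def set_lebesgue_integral_def K_def
    by (subst integral_eq_nn_integral) (auto simp: cosh_real_nonneg)
  with \<open>K \<noteq> top\<close> have "ennreal (bessel_K \<nu> y) = K" by (simp add: top.not_eq_extremum)
  then have "(\<integral>\<^sup>+v. ennreal (indicator {0<..} v * f v) \<partial>lborel) = ennreal ((y / 2) powr \<nu> * (2 * bessel_K \<nu> y))"
    using eq by (simp add: ennreal_mult' bessel_K_nonneg)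
  also have "(y / 2) powr \<nu> * (2 * bessel_K \<nu> y) = 2 powr (1 - \<nu>) * bessel_G \<nu> y"
    using y by (simp add: bessel_G_def powr_divide powr_diff)
  finally show ?thesis by (simp add: f_def)
qed

text \<open>By the integral representation, a moment of \<open>bessel_G\<close> is a mixture of Gaussian moments.\<close>

lemma nn_integral_bessel_G_moment:
  assumes \<nu>: "\<nu> > -1" "\<nu> + (real n + 1) / 2 > 0"
    and c: "(\<integral>\<^sup>+x. ennreal (indicator {0<..} x * (x ^ n * exp (- x\<^sup>2))) \<partial>lborel) = ennreal c" "c \<ge> 0"
  shows "(\<integral>\<^sup>+y. ennreal (indicator {0<..} y * (y ^ n * bessel_G \<nu> y)) \<partial>lborel)
       = ennreal (2 powr (\<nu> + n) * c * Gamma (\<nu> + (real n + 1) / 2))"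
proof -
  define p where "p = (real n + 1) / 2"
  have inner: "(\<integral>\<^sup>+y. ennreal (indicator {0<..} y * (y ^ n * exp (- y\<^sup>2 / (4 * v)))) \<partial>lborel)
     = ennreal (c * 2 ^ Suc n * v powr p)" if v: "v > 0" for v
  proof -
    \<comment> \<open>The scale at which \<open>exp (- y\<^sup>2 / (4 * v))\<close> becomes the
      standard Gaussian. The \<open>n\<close> powers of \<open>y\<close> and the differential
      contribute \<open>(1 / d) ^ (n + 1)\<close>, that is,
      \<open>2 ^ (n + 1) * v powr p\<close>.\<close>
    define d where "d = 1 / (2 * sqrt v)"
    have d: "d > 0" using v by (simp add: d_def)
    have d2: "(d * y)\<^sup>2 = y\<^sup>2 / (4 * v)" for y
      using v by (simp add: d_def power_mult_distrib power_divide)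
    have "(1 / d) ^ Suc n = 2 ^ Suc n * (sqrt v) ^ Suc n"
      by (simp only: d_def power_mult_distrib div_by_1 divide_divide_eq_right mult_1)
    also have "sqrt v ^ Suc n = v powr p"
      using v by (simp add: powr_half_sqrt[symmetric] powr_realpow[symmetric] powr_powr p_def field_simps
           del: power_Suc)
    finally have dd: "(1 / d) ^ Suc n = 2 ^ Suc n * v powr p" .
    have "(\<integral>\<^sup>+y. ennreal (indicator {0<..} y * (y ^ n * exp (- y\<^sup>2 / (4 * v)))) \<partial>lborel)
      = (\<integral>\<^sup>+y. ennreal ((1 / d) ^ Suc n) * ennreal (indicator {0<..} y * ((d * y) ^ n * exp (- (d * y)\<^sup>2) * d)) \<partial>lborel)"
      using d unfolding d2
      by (intro nn_integral_cong)
         (auto simp: ennreal_mult'[symmetric] indicator_def power_mult_distrib field_simps)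
    also have "\<dots> = ennreal ((1 / d) ^ Suc n) * ennreal c"
      by (subst nn_integral_cmult, measurable)
         (subst nn_integral_scale_substitution[where f = "\<lambda>x. x ^ n * exp (- x\<^sup>2)"], use d c in auto)
    finally show ?thesis
      using c d unfolding dd by (simp add: ennreal_mult'[symmetric] mult_ac)
  qed
  have "(\<integral>\<^sup>+y. ennreal (indicator {0<..} y * (y ^ n * bessel_G \<nu> y)) \<partial>lborel)
    = (\<integral>\<^sup>+y. (\<integral>\<^sup>+v. ennreal (2 powr (\<nu> - 1) * (indicator {0<..} v * (v powr (\<nu> - 1) * exp (- v)))
        * (indicator {0<..} y * (y ^ n * exp (- y\<^sup>2 / (4 * v))))) \<partial>lborel) \<partial>lborel)"
  proof (rule nn_integral_cong)
    fix y :: real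
    show "ennreal (indicator {0<..} y * (y ^ n * bessel_G \<nu> y)) = 
      (\<integral>\<^sup>+v. ennreal (2 powr (\<nu> - 1) * (indicator {0<..} v * (v powr (\<nu> - 1) * exp (- v)))
        * (indicator {0<..} y * (y ^ n * exp (- y\<^sup>2 / (4 * v))))) \<partial>lborel)"
    proof (cases "y > 0")
      case True
      have "(\<integral>\<^sup>+v. ennreal (2 powr (\<nu> - 1) * (indicator {0<..} v * (v powr (\<nu> - 1) * exp (- v)))
        * (indicator {0<..} y * (y ^ n * exp (- y\<^sup>2 / (4 * v))))) \<partial>lborel)
       = (\<integral>\<^sup>+v. ennreal (2 powr (\<nu> - 1) * y ^ n) *
           ennreal (indicator {0<..} v * (v powr (\<nu> - 1) * exp (- v - y\<^sup>2 / (4 * v)))) \<partial>lborel)"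
        using True by (intro nn_integral_cong)
          (auto simp: ennreal_mult'[symmetric] indicator_def exp_diff exp_minus field_simps)
      also have "\<dots> = ennreal (2 powr (\<nu> - 1) * y ^ n) * ennreal (2 powr (1 - \<nu>) * bessel_G \<nu> y)"
        by (subst nn_integral_cmult, measurable) (simp add: bessel_G_integral_representation[OF \<nu>(1) True])
      also have "\<dots> = ennreal (y ^ n * bessel_G \<nu> y * (2 powr (\<nu> - 1) * 2 powr (1 - \<nu>)))"
        using True by (simp add: ennreal_mult'[symmetric] bessel_G_nonneg mult_ac)
      finally show ?thesis using True by (simp add: powr_add[symmetric])
    qed auto
  qed
  also have "\<dots> = (\<integral>\<^sup>+v. (\<integral>\<^sup>+y. ennreal (2 powr (\<nu> - 1) * (indicator {0<..} v * (v powr (\<nu> - 1) * exp (- v)))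
        * (indicator {0<..} y * (y ^ n * exp (- y\<^sup>2 / (4 * v))))) \<partial>lborel) \<partial>lborel)"
    by (rule lborel_pair.Fubini') measurable
  also have "\<dots> = (\<integral>\<^sup>+v. ennreal (2 powr (\<nu> + n) * c) *
      ennreal (indicator {0<..} v * (v powr (\<nu> + p - 1) * exp (- 1 * v))) \<partial>lborel)"
  proof (rule nn_integral_cong)
    fix v :: real
    show "(\<integral>\<^sup>+y. ennreal (2 powr (\<nu> - 1) * (indicator {0<..} v * (v powr (\<nu> - 1) * exp (- v)))
        * (indicator {0<..} y * (y ^ n * exp (- y\<^sup>2 / (4 * v))))) \<partial>lborel)
        = ennreal (2 powr (\<nu> + n) * c) *
      ennreal (indicator {0<..} v * (v powr (\<nu> + p - 1) * exp (- 1 * v)))"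
    proof (cases "v > 0")
      case True
      have "(\<integral>\<^sup>+y. ennreal (2 powr (\<nu> - 1) * (indicator {0<..} v * (v powr (\<nu> - 1) * exp (- v)))
        * (indicator {0<..} y * (y ^ n * exp (- y\<^sup>2 / (4 * v))))) \<partial>lborel)
       = (\<integral>\<^sup>+y. ennreal (2 powr (\<nu> - 1) * (v powr (\<nu> - 1) * exp (- v))) * 
         ennreal (indicator {0<..} y * (y ^ n * exp (- y\<^sup>2 / (4 * v)))) \<partial>lborel)"
        using True by (intro nn_integral_cong) (simp add: ennreal_mult'[symmetric])
      also have "\<dots> = ennreal (2 powr (\<nu> - 1) * (v powr (\<nu> - 1) * exp (- v))) * ennreal (c * 2 ^ Suc n * v powr p)"
        by (subst nn_integral_cmult, measurable) (simp only: inner[OF True])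
      also have "\<dots> = ennreal (2 powr (\<nu> - 1) * (v powr (\<nu> - 1) * exp (- v)) * (c * 2 ^ Suc n * v powr p))"
        using c by (intro ennreal_mult'[symmetric]) auto
      also have "2 powr (\<nu> - 1) * (v powr (\<nu> - 1) * exp (- v)) * (c * 2 ^ Suc n * v powr p)
           = (2 powr (\<nu> - 1) * 2 ^ Suc n * c) * ((v powr (\<nu> - 1) * v powr p) * exp (- v))"
        by (simp only: mult_ac)
      also have "2 powr (\<nu> - 1) * 2 ^ Suc n = 2 powr (\<nu> + n)"
        by (simp add: powr_realpow powr_diff powr_add)
      also have "v powr (\<nu> - 1) * v powr p = v powr (\<nu> + p - 1)"
        by (simp add: powr_add[symmetric] algebra_simps)
      finally show ?thesis using True c by (simp add: ennreal_mult')
    qed auto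
  qed
  also have "\<dots> = ennreal (2 powr (\<nu> + n) * c) * ennreal (Gamma (\<nu> + p) / 1 powr (\<nu> + p))"
    by (subst nn_integral_cmult, measurable)
       (subst nn_integral_Gamma_scaled, use \<nu> in \<open>auto simp: p_def\<close>)
  also have "\<dots> = ennreal (2 powr (\<nu> + n) * c * Gamma (\<nu> + p))"
    using c by (simp add: ennreal_mult')
  finally show ?thesis by (simp add: p_def)
qed

text \<open>The Gaussian moment of order \<open>2 * l + 1\<close> on the half line is
  \<open>fact l / 2\<close>, and half of \<open>(2 * l + 1) + 1\<close> is the integer
  \<open>l + 1\<close>, which is the shift in the Gamma factor.\<close>

lemma has_bochner_integral_bessel_G_odd_moment:
  assumes \<nu>: "\<nu> > -1"
  shows "has_bochner_integral lborel (\<lambda>y. indicator {0<..} y * (y ^ (2 * l + 1) * bessel_G \<nu> y))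
           (2 powr (\<nu> + 2 * real l) * fact l * Gamma (\<nu> + real l + 1))"
proof -
  have "(\<integral>\<^sup>+x. ennreal (indicator {0<..} x * (x ^ (2 * l + 1) * exp (- x\<^sup>2))) \<partial>lborel)
      = (\<integral>\<^sup>+x. ennreal (indicator {0..} x *\<^sub>R (exp (- x\<^sup>2) * x ^ (2 * l + 1))) \<partial>lborel)"
    by (intro nn_integral_cong) (auto simp: indicator_def)
  also have "\<dots> = ennreal (fact l / 2)"
    using gaussian_moment_odd_pos[of l]
    by (subst nn_integral_eq_integral) (auto simp: has_bochner_integral_iff indicator_def)
  finally have *: "(\<integral>\<^sup>+x. ennreal (indicator {0<..} x * (x ^ (2 * l + 1) * exp (- x\<^sup>2))) \<partial>lborel)
      = ennreal (fact l / 2)" .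
  have "(\<integral>\<^sup>+y. ennreal (indicator {0<..} y * (y ^ (2 * l + 1) * bessel_G \<nu> y)) \<partial>lborel)
      = ennreal (2 powr (\<nu> + real (2 * l + 1)) * (fact l / 2) * Gamma (\<nu> + (real (2 * l + 1) + 1) / 2))"
    by (rule nn_integral_bessel_G_moment) (use \<nu> * in \<open>auto simp: field_simps\<close>)
  also have "2 powr (\<nu> + real (2 * l + 1)) * (fact l / 2) * Gamma (\<nu> + (real (2 * l + 1) + 1) / 2)
      = 2 powr (\<nu> + 2 * real l) * fact l * Gamma (\<nu> + real l + 1)"
  proof -
    have "2 powr (\<nu> + real (2 * l + 1)) = 2 * 2 powr (\<nu> + 2 * real l)"
      by (simp add: powr_add)
    moreover have "\<nu> + (real (2 * l + 1) + 1) / 2 = \<nu> + real l + 1" by (simp add: field_simps)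
    ultimately show ?thesis by (simp only:)
  qed
  finally show ?thesis
    using \<nu> by (intro has_bochner_integral_nn_integral)
      (auto simp: bessel_G_nonneg indicator_def intro!: Gamma_real_nonneg)
qed

text \<open>The moment of order 0, with value proportional to \<open>Gamma (\<nu> + 1/2)\<close>. It
  controls a neighbourhood of 0, which the odd moments do not.\<close>

lemma integrable_bessel_G:
  assumes \<nu>: "\<nu> > -1/2"
  shows "integrable lborel (\<lambda>y. indicator {0<..} y * bessel_G \<nu> y)"
proof -
  have "(\<integral>\<^sup>+x. ennreal (indicator {0<..} x * (x ^ 0 * exp (- x\<^sup>2))) \<partial>lborel)
      = (\<integral>\<^sup>+x. ennreal (indicator {0..} x *\<^sub>R exp (- x\<^sup>2)) \<partial>lborel)"
    by (intro nn_integral_cong_AE AE_I[where N = "{0}"]) (auto simp: indicator_def)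
  also have "\<dots> = ennreal (sqrt pi / 2)"
    using gaussian_moment_0
    by (subst nn_integral_eq_integral) (auto simp: has_bochner_integral_iff indicator_def)
  finally have "(\<integral>\<^sup>+y. ennreal (indicator {0<..} y * (y ^ 0 * bessel_G \<nu> y)) \<partial>lborel)
      = ennreal (2 powr (\<nu> + real 0) * (sqrt pi / 2) * Gamma (\<nu> + (real 0 + 1) / 2))"
    by (intro nn_integral_bessel_G_moment) (use \<nu> in auto)
  then show ?thesis
    by (intro integrableI_nonneg) (auto simp: bessel_G_nonneg)
qed

section \<open>Hypergeometric series\<close>

lemma LIMSEQ_shifted_ratio:
  fixes a c :: real
  shows "(\<lambda>n. (a + real n) / (c + real n)) \<longlonglongrightarrow> 1"
proof -
  have top: "filterlim (\<lambda>n. c + real n) at_top sequentially"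
    by (intro filterlim_tendsto_add_at_top[OF tendsto_const] filterlim_real_sequentially)
  have "(\<lambda>n. 1 + (a - c) / (c + real n)) \<longlonglongrightarrow> 1 + 0"
    by (intro tendsto_add tendsto_const tendsto_divide_0[OF tendsto_const]
          filterlim_at_top_imp_at_infinity top)
  moreover have "eventually (\<lambda>n. 1 + (a - c) / (c + real n) = (a + real n) / (c + real n)) sequentially"
    using filterlim_at_top_dense[THEN iffD1, OF top, rule_format, of 0]
    by eventually_elim (auto simp: field_simps)
  ultimately show ?thesis by (simp add: filterlim_cong)
qed

text \<open>The ratio of consecutive terms tends to \<open>z\<close>, so the ratio test works with
  the midpoint of \<open>\<bar>z\<bar>\<close> and 1. Absolute summability is recorded as well,
  because termwise integration rests on it.\<close>

lemma hyp2F1_sums: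
  fixes a b c z :: real
  assumes pos: "a > 0" "b > 0" "c > 0" and z: "\<bar>z\<bar> < 1"
  shows "summable (\<lambda>n. norm (pochhammer a n * pochhammer b n / (pochhammer c n * fact n) * z ^ n))"
    and "(\<lambda>n. pochhammer a n * pochhammer b n / (pochhammer c n * fact n) * z ^ n) sums hyp2F1 a b c z"
proof -
  let ?f = "\<lambda>n. pochhammer a n * pochhammer b n / (pochhammer c n * fact n) * z ^ n"
  have ratio: "?f (Suc n) = ?f n * ((a + n) / (c + n) * ((b + n) / (1 + n)) * z)" for n
    by (simp add: pochhammer_Suc) (simp add: field_simps)
  have "(\<lambda>n. (a + real n) / (c + real n) * ((b + real n) / (1 + real n)) * \<bar>z\<bar>) \<longlonglongrightarrow> 1 * 1 * \<bar>z\<bar>"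
    by (intro tendsto_mult tendsto_const LIMSEQ_shifted_ratio)
  then have "eventually (\<lambda>n. (a + real n) / (c + real n) * ((b + real n) / (1 + real n)) * \<bar>z\<bar> < (1 + \<bar>z\<bar>) / 2) sequentially"
    using z by (intro order_tendstoD) auto
  then obtain N where N: "\<And>n. n \<ge> N \<Longrightarrow> (a + real n) / (c + real n) * ((b + real n) / (1 + real n)) * \<bar>z\<bar> < (1 + \<bar>z\<bar>) / 2"
    by (auto simp: eventually_sequentially)
  show "summable (\<lambda>n. norm (?f n))"
  proof (rule summable_ratio_test[where c = "(1 + \<bar>z\<bar>) / 2" and N = N])
    show "(1 + \<bar>z\<bar>) / 2 < 1" using z by simp
    fix n assume n: "n \<ge> N"
    have "norm (norm (?f (Suc n))) = norm (?f n) * ((a + n) / (c + n) * ((b + n) / (1 + n)) * \<bar>z\<bar>)"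
      unfolding ratio using pos by (simp add: abs_mult)
    also have "\<dots> \<le> norm (?f n) * ((1 + \<bar>z\<bar>) / 2)"
      using N[OF n] by (intro mult_left_mono) auto
    finally show "norm (norm (?f (Suc n))) \<le> (1 + \<bar>z\<bar>) / 2 * norm (norm (?f n))"
      by (simp add: mult.commute)
  qed
  then have "summable ?f" by (rule summable_norm_cancel)
  then have "?f sums suminf ?f" by (rule summable_sums)
  also have "suminf ?f = hyp2F1 a b c z"
    unfolding hyp2F1_def eval_fps_def by (intro suminf_cong) (simp add: mult_ac)
  finally show "?f sums hyp2F1 a b c z" .
qed

text \<open>The index \<open>l\<close> belongs to the moment of order
  \<open>2 * l + 1\<close>.\<close>

definition bessel_moment :: "real \<Rightarrow> nat \<Rightarrow> real" where
  "bessel_moment \<nu> l = 2 powr (\<nu> + 2 * real l) * fact l * Gamma (\<nu> + real l + 1)"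

lemma bessel_moment_nonneg: "\<nu> > -1 \<Longrightarrow> bessel_moment \<nu> l \<ge> 0"
  by (simp add: bessel_moment_def Gamma_real_nonneg)

text \<open>Shifting the index produces the two numerator Pochhammer symbols of a Gauss series; the
  power of 4 will cancel against the one in \<open>fact (2 * i)\<close> or
  \<open>fact (2 * i + 1)\<close>.\<close>

lemma bessel_moment_add:
  assumes "\<nu> > -1"
  shows "bessel_moment \<nu> (l + i) = bessel_moment \<nu> l *
           (4 ^ i * pochhammer (real l + 1) i * pochhammer (\<nu> + real l + 1) i)"
proof -
  have not: "real l + 1 \<notin> \<int>\<^sub>\<le>\<^sub>0" "\<nu> + real l + 1 \<notin> \<int>\<^sub>\<le>\<^sub>0"
    using assms by (auto dest!: nonpos_Ints_nonpos)
  have nz: "Gamma (\<nu> + real l + 1) \<noteq> 0"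
    using assms by (intro less_imp_neq[symmetric] Gamma_real_pos) simp
  have "fact (l + i) = fact l * pochhammer (real l + 1) i"
    using not(1) Gamma_fact[of l, where ?'a = real] Gamma_fact[of "l + i", where ?'a = real]
    by (simp add: pochhammer_Gamma add_ac)
  moreover have "Gamma (\<nu> + real (l + i) + 1) = Gamma (\<nu> + real l + 1) * pochhammer (\<nu> + real l + 1) i"
    using not(2) nz by (simp add: pochhammer_Gamma add_ac)
  moreover have "2 powr (\<nu> + 2 * real (l + i)) = 2 powr (\<nu> + 2 * real l) * 4 ^ i"
  proof -
    have "2 powr (\<nu> + 2 * real (l + i)) = 2 powr (\<nu> + 2 * real l) * 2 powr (real (2 * i))"
      by (simp add: powr_add[symmetric] algebra_simps)
    also have "2 powr (real (2 * i)) = (4::real) ^ i" by (subst powr_realpow) (auto simp: power_mult)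
    finally show ?thesis .
  qed
  ultimately show ?thesis by (simp add: bessel_moment_def)
qed

text \<open>The assumption \<open>sm\<close> is summability of the L1 norms of the terms, which
  justifies exchanging sum and integral. One lemma serves cosh times an odd power and sinh times an
  even power, since either product expands in odd powers of \<open>y\<close> from
  \<open>2 * l + 1\<close> on.\<close>

lemma has_bochner_integral_series_bessel_G:
  assumes \<nu>: "\<nu> > -1"
    and sm: "summable (\<lambda>i. \<bar>a i\<bar> * bessel_moment \<nu> (l + i))"
    and ab: "\<And>y. y > 0 \<Longrightarrow> summable (\<lambda>i. \<bar>a i * y ^ (2 * (l + i) + 1)\<bar>)"
    and g: "\<And>y. y > 0 \<Longrightarrow> (\<lambda>i. a i * y ^ (2 * (l + i) + 1)) sums g y"
  shows "has_bochner_integral lborel (\<lambda>y. indicator {0<..} y * (g y * bessel_G \<nu> y))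
           (\<Sum>i. a i * bessel_moment \<nu> (l + i))"
proof -
  define f where "f = (\<lambda>i y. a i * (indicator {0<..} y * (y ^ (2 * (l + i) + 1) * bessel_G \<nu> y)))"
  have hb: "has_bochner_integral lborel (f i) (a i * bessel_moment \<nu> (l + i))" for i
    unfolding f_def bessel_moment_def
    by (intro has_bochner_integral_mult_right has_bochner_integral_bessel_G_odd_moment \<nu>)
  have nf: "norm (f i y) = \<bar>a i\<bar> * (indicator {0<..} y * (y ^ (2 * (l + i) + 1) * bessel_G \<nu> y))" for i y
    by (auto simp: f_def abs_mult indicator_def bessel_G_nonneg)
  have hbn: "has_bochner_integral lborel (\<lambda>y. norm (f i y)) (\<bar>a i\<bar> * bessel_moment \<nu> (l + i))" for i
    unfolding nf bessel_moment_def
    by (intro has_bochner_integral_mult_right has_bochner_integral_bessel_G_odd_moment \<nu>)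
  have 1: "integrable lborel (f i)" for i using hb by (auto simp: has_bochner_integral_iff)
  have 2: "AE y in lborel. summable (\<lambda>i. norm (f i y))"
  proof (rule AE_I2)
    fix y :: real
    show "summable (\<lambda>i. norm (f i y))"
    proof (cases "y > 0")
      case True
      then have "norm (f i y) = \<bar>a i * y ^ (2 * (l + i) + 1)\<bar> * bessel_G \<nu> y" for i
        unfolding nf by (simp add: abs_mult)
      then show ?thesis by (simp only: summable_mult2[OF ab[OF True]])
    qed (simp add: f_def)
  qed
  have 3: "summable (\<lambda>i. \<integral>y. norm (f i y) \<partial>lborel)"
    using hbn sm by (simp add: has_bochner_integral_iff)
  have eq: "(\<lambda>y. \<Sum>i. f i y) = (\<lambda>y. indicator {0<..} y * (g y * bessel_G \<nu> y))"
  proof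
    fix y :: real
    show "(\<Sum>i. f i y) = indicator {0<..} y * (g y * bessel_G \<nu> y)"
    proof (cases "y > 0")
      case True
      then show ?thesis
        using sums_unique[OF sums_mult2[OF g[OF True], of "bessel_G \<nu> y"]]
        by (simp add: f_def mult_ac)
    qed (simp add: f_def)
  qed
  have "(\<Sum>i. integral\<^sup>L lborel (f i)) = (\<Sum>i. a i * bessel_moment \<nu> (l + i))"
    using hb by (simp add: has_bochner_integral_iff)
  then show ?thesis
    using integrable_suminf[OF 1 2 3] integral_suminf[OF 1 2 3]
    by (simp add: has_bochner_integral_iff eq)
qed

section \<open>Hyperbolic functions integrated against G\<close>

lemma cosh_sums: "(\<lambda>i. x ^ (2 * i) / fact (2 * i)) sums cosh (x :: real)"
proof -
  have "(\<lambda>i. (\<lambda>n. if even n then x ^ n /\<^sub>R fact n else 0) (2 * i)) sums cosh x"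
    by (subst sums_mono_reindex) (auto simp: strict_mono_def cosh_converges elim!: evenE)
  then show ?thesis by (simp add: field_simps)
qed

lemma sinh_sums: "(\<lambda>i. x ^ (2 * i + 1) / fact (2 * i + 1)) sums sinh (x :: real)"
proof -
  have "(\<lambda>i. (\<lambda>n. if even n then 0 else x ^ n /\<^sub>R fact n) (2 * i + 1)) sums sinh x"
    by (subst sums_mono_reindex) (auto simp: strict_mono_def sinh_converges elim!: oddE)
  then show ?thesis by (simp add: field_simps del: fact_Suc)
qed

text \<open>Counterpart of \<open>fact_double\<close> for odd arguments. The extra factor
  \<open>2 * i + 1\<close> moves the Pochhammer base from 1/2 to 3/2, the lower parameter of the
  sinh integrals.\<close>

lemma fact_double_Suc: "(fact (2 * i + 1) :: real) = 4 ^ i * pochhammer (3 / 2) i * fact i"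
proof -
  have "1 / 2 * pochhammer (3 / 2) i = pochhammer (1 / 2) i * (1 / 2 + real i)"
    using pochhammer_rec[of "1 / 2 :: real" i] by (simp add: pochhammer_Suc)
  moreover have "(fact (2 * i) :: real) = 4 ^ i * pochhammer (1 / 2) i * fact i"
    using fact_double[of i, where ?'a = real] by (simp add: power_mult)
  ultimately show ?thesis by (simp add: algebra_simps)
qed

text \<open>In the expansion of cosh,
  \<open>fact (2 * i) = 4 ^ i * pochhammer (1/2) i * fact i\<close> supplies the denominator of the
  Gauss series, and \<open>bessel_moment_add\<close> supplies its numerator together with the
  matching \<open>4 ^ i\<close>.\<close>

lemma has_bochner_integral_cosh_bessel_G:
  assumes \<nu>: "\<nu> > -1" and b: "\<bar>b\<bar> < 1"
  shows "has_bochner_integral lborel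
           (\<lambda>y. indicator {0<..} y * ((y ^ (2 * l + 1) * cosh (b * y)) * bessel_G \<nu> y))
           (bessel_moment \<nu> l * hyp2F1 (real l + 1) (\<nu> + real l + 1) (1/2) (b\<^sup>2))"
proof -
  define a where "a = (\<lambda>i. b ^ (2 * i) / fact (2 * i))"
  let ?h = "\<lambda>i. pochhammer (real l + 1) i * pochhammer (\<nu> + real l + 1) i / (pochhammer (1/2) i * fact i) * (b\<^sup>2) ^ i"
  have b2: "\<bar>b\<^sup>2\<bar> < 1" using b by (simp add: abs_square_less_1)
  have a: "a i * bessel_moment \<nu> (l + i) = bessel_moment \<nu> l * ?h i" for i
  proof -
    have "(fact (2 * i) :: real) = 4 ^ i * pochhammer (1 / 2) i * fact i"
      using fact_double[of i, where ?'a = real] by (simp add: power_mult)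
    then show ?thesis
      unfolding a_def bessel_moment_add[OF \<nu>] by (simp add: power_mult)
  qed
  note H = hyp2F1_sums[of "real l + 1" "\<nu> + real l + 1" "1/2" "b\<^sup>2"]
  have sums: "(\<lambda>i. a i * bessel_moment \<nu> (l + i)) sums
      (bessel_moment \<nu> l * hyp2F1 (real l + 1) (\<nu> + real l + 1) (1/2) (b\<^sup>2))"
    unfolding a using \<nu> b2 by (intro sums_mult H) auto
  have "has_bochner_integral lborel
      (\<lambda>y. indicator {0<..} y * ((y ^ (2 * l + 1) * cosh (b * y)) * bessel_G \<nu> y))
      (\<Sum>i. a i * bessel_moment \<nu> (l + i))"
  proof (rule has_bochner_integral_series_bessel_G[OF \<nu>])
    have "summable (\<lambda>i. bessel_moment \<nu> l * norm (?h i))"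
      using \<nu> b2 by (intro summable_mult H) auto
    moreover have "bessel_moment \<nu> l * norm (?h i) = \<bar>a i\<bar> * bessel_moment \<nu> (l + i)" for i
      using arg_cong[OF a[of i], of abs] bessel_moment_nonneg[OF \<nu>] by (simp add: abs_mult)
    ultimately show "summable (\<lambda>i. \<bar>a i\<bar> * bessel_moment \<nu> (l + i))" by simp
  next
    fix y :: real assume "y > 0"
    have *: "a i * y ^ (2 * (l + i) + 1) = y ^ (2 * l + 1) * ((b * y) ^ (2 * i) / fact (2 * i))" for i
      by (simp add: a_def power_mult_distrib power_add distrib_left)
    show "(\<lambda>i. a i * y ^ (2 * (l + i) + 1)) sums (y ^ (2 * l + 1) * cosh (b * y))"
      unfolding * by (intro sums_mult cosh_sums)
    have **: "\<bar>a i * y ^ (2 * (l + i) + 1)\<bar> = \<bar>y ^ (2 * l + 1)\<bar> * (\<bar>b * y\<bar> ^ (2 * i) / fact (2 * i))" for i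
      unfolding * by (simp only: abs_mult abs_divide power_abs abs_of_nonneg[OF fact_ge_zero])
    show "summable (\<lambda>i. \<bar>a i * y ^ (2 * (l + i) + 1)\<bar>)"
      unfolding ** by (intro summable_mult sums_summable[OF cosh_sums])
  qed
  with sums show ?thesis by (simp add: sums_iff)
qed

text \<open>The odd powers of \<open>b\<close> leave one factor \<open>b\<close> in front of a
  series in \<open>b\<^sup>2\<close>, and \<open>fact_double_Suc\<close> gives the lower parameter
  3/2. The even power \<open>2 * l\<close> again leads to moments of odd order.\<close>

lemma has_bochner_integral_sinh_bessel_G:
  assumes \<nu>: "\<nu> > -1" and b: "\<bar>b\<bar> < 1"
  shows "has_bochner_integral lborel
           (\<lambda>y. indicator {0<..} y * ((y ^ (2 * l) * sinh (b * y)) * bessel_G \<nu> y))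
           (b * (bessel_moment \<nu> l * hyp2F1 (real l + 1) (\<nu> + real l + 1) (3/2) (b\<^sup>2)))"
proof -
  define a where "a = (\<lambda>i. b ^ (2 * i + 1) / fact (2 * i + 1))"
  let ?h = "\<lambda>i. pochhammer (real l + 1) i * pochhammer (\<nu> + real l + 1) i / (pochhammer (3/2) i * fact i) * (b\<^sup>2) ^ i"
  have b2: "\<bar>b\<^sup>2\<bar> < 1" using b by (simp add: abs_square_less_1)
  have a: "a i * bessel_moment \<nu> (l + i) = b * (bessel_moment \<nu> l * ?h i)" for i
    unfolding a_def bessel_moment_add[OF \<nu>] fact_double_Suc by (simp add: power_mult)
  note H = hyp2F1_sums[of "real l + 1" "\<nu> + real l + 1" "3/2" "b\<^sup>2"]
  have sums: "(\<lambda>i. a i * bessel_moment \<nu> (l + i)) sums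
      (b * (bessel_moment \<nu> l * hyp2F1 (real l + 1) (\<nu> + real l + 1) (3/2) (b\<^sup>2)))"
    unfolding a using \<nu> b2 by (intro sums_mult H) auto
  have "has_bochner_integral lborel
      (\<lambda>y. indicator {0<..} y * ((y ^ (2 * l) * sinh (b * y)) * bessel_G \<nu> y))
      (\<Sum>i. a i * bessel_moment \<nu> (l + i))"
  proof (rule has_bochner_integral_series_bessel_G[OF \<nu>])
    have "summable (\<lambda>i. \<bar>b\<bar> * (bessel_moment \<nu> l * norm (?h i)))"
      using \<nu> b2 by (intro summable_mult H) auto
    moreover have "\<bar>b\<bar> * (bessel_moment \<nu> l * norm (?h i)) = \<bar>a i\<bar> * bessel_moment \<nu> (l + i)" for i
      using arg_cong[OF a[of i], of abs] bessel_moment_nonneg[OF \<nu>] by (simp add: abs_mult)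
    ultimately show "summable (\<lambda>i. \<bar>a i\<bar> * bessel_moment \<nu> (l + i))" by simp
  next
    fix y :: real assume "y > 0"
    have *: "a i * y ^ (2 * (l + i) + 1) = y ^ (2 * l) * ((b * y) ^ (2 * i + 1) / fact (2 * i + 1))" for i
      by (simp add: a_def power_mult_distrib power_add distrib_left)
    show "(\<lambda>i. a i * y ^ (2 * (l + i) + 1)) sums (y ^ (2 * l) * sinh (b * y))"
      unfolding * by (intro sums_mult sinh_sums)
    have **: "\<bar>a i * y ^ (2 * (l + i) + 1)\<bar> = \<bar>y ^ (2 * l)\<bar> * (\<bar>b * y\<bar> ^ (2 * i + 1) / fact (2 * i + 1))" for i
      unfolding * by (simp only: abs_mult abs_divide power_abs abs_of_nonneg[OF fact_ge_zero])
    show "summable (\<lambda>i. \<bar>a i * y ^ (2 * (l + i) + 1)\<bar>)"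
      unfolding ** by (intro summable_mult sums_summable[OF sinh_sums])
  qed
  with sums show ?thesis by (simp add: sums_iff)
qed

section \<open>The moment of odd order and its remainder\<close>

text \<open>Even powers lie outside the odd moments, hence a comparison: on (0,1] the factor is at
  most \<open>exp 1\<close>, and beyond 1 the power may be raised to the odd order
  \<open>2 * m + 1\<close> while \<open>exp (c * y) \<le> 2 * cosh (c * y)\<close>.\<close>

lemma integrable_power_exp_bessel_G:
  assumes \<nu>: "\<nu> > -1/2" and c: "\<bar>c\<bar> < 1"
  shows "integrable lborel (\<lambda>y. indicator {0<..} y * ((y ^ m * exp (c * y)) * bessel_G \<nu> y))"
proof (rule Bochner_Integration.integrable_bound)
  have "integrable lborel (\<lambda>y. indicator {0<..} y * ((y ^ (2 * m + 1) * cosh (c * y)) * bessel_G \<nu> y))"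
    using has_bochner_integral_cosh_bessel_G[of \<nu> c m] \<nu> c by (simp add: has_bochner_integral_iff)
  then show "integrable lborel (\<lambda>y. exp 1 * (indicator {0<..} y * bessel_G \<nu> y) +
      2 * (indicator {0<..} y * ((y ^ (2 * m + 1) * cosh (c * y)) * bessel_G \<nu> y)))"
    by (intro Bochner_Integration.integrable_add integrable_mult_right integrable_bessel_G \<nu>)
  show "(\<lambda>y. indicator {0<..} y * ((y ^ m * exp (c * y)) * bessel_G \<nu> y)) \<in> borel_measurable lborel"
    by measurable
  have *: "y ^ m * exp (c * y) \<le> exp 1 + 2 * (y ^ (2 * m + 1) * cosh (c * y))" if "y > 0" for y
  proof (cases "y \<le> 1")
    case True
    have "c * y \<le> 1 * 1" using c that True by (intro mult_mono) auto
    moreover have "y ^ m \<le> 1" using that True by (simp add: power_le_one)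
    ultimately have "y ^ m * exp (c * y) \<le> 1 * exp 1" using that by (intro mult_mono) auto
    moreover have "0 \<le> 2 * (y ^ (2 * m + 1) * cosh (c * y))" using that by (simp add: cosh_real_nonneg)
    ultimately show ?thesis by linarith
  next
    case False
    have "exp (c * y) \<le> 2 * cosh (c * y)" by (simp add: cosh_field_def)
    moreover have "y ^ m \<le> y ^ (2 * m + 1)" using False by (intro power_increasing) auto
    ultimately have "y ^ m * exp (c * y) \<le> y ^ (2 * m + 1) * (2 * cosh (c * y))"
      using that by (intro mult_mono) auto
    moreover have "exp 1 > (0::real)" by simp
    ultimately show ?thesis by linarith
  qed
  show "AE y in lborel. norm (indicator {0<..} y * ((y ^ m * exp (c * y)) * bessel_G \<nu> y)) \<le>
      norm (exp 1 * (indicator {0<..} y * bessel_G \<nu> y) +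
      2 * (indicator {0<..} y * ((y ^ (2 * m + 1) * cosh (c * y)) * bessel_G \<nu> y)))"
  proof (rule AE_I2)
    fix y :: real
    have "(y ^ m * exp (c * y)) * bessel_G \<nu> y \<le> (exp 1 + 2 * (y ^ (2 * m + 1) * cosh (c * y))) * bessel_G \<nu> y" if "y > 0"
      using *[OF that] by (intro mult_right_mono bessel_G_nonneg)
    then show "norm (indicator {0<..} y * ((y ^ m * exp (c * y)) * bessel_G \<nu> y)) \<le>
      norm (exp 1 * (indicator {0<..} y * bessel_G \<nu> y) +
      2 * (indicator {0<..} y * ((y ^ (2 * m + 1) * cosh (c * y)) * bessel_G \<nu> y)))"
      by (auto simp: indicator_def bessel_G_nonneg cosh_real_nonneg abs_mult algebra_simps)
  qed
qed

text \<open>Only the sum of the two halves is going to be evaluated. Separate integrability allows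
  it to be split, the second half to be reflected, and the two to be recombined over the whole
  line.\<close>

lemma has_bochner_integral_two_sided:
  fixes p q :: "real \<Rightarrow> real"
  assumes "integrable lborel (\<lambda>s. indicator {0<..} s * p s)"
    and "integrable lborel (\<lambda>s. indicator {0<..} s * q s)"
    and "has_bochner_integral lborel (\<lambda>s. indicator {0<..} s * (p s + q s)) I"
  shows "has_bochner_integral lborel
           (\<lambda>s. indicator {0<..} s * p s + indicator {0<..} (- s) * q (- s)) I"
proof -
  have q: "has_bochner_integral lborel (\<lambda>s. indicator {0<..} (- s) * q (- s))
          (integral\<^sup>L lborel (\<lambda>s. indicator {0<..} s * q s))"
    using assms(2)[THEN has_bochner_integral_integrable]
    by (subst (asm) lborel_has_bochner_integral_real_affine_iff[where c = "-1" and t = 0]) auto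
  have "has_bochner_integral lborel (\<lambda>s. indicator {0<..} s * p s + indicator {0<..} s * q s)
     (integral\<^sup>L lborel (\<lambda>s. indicator {0<..} s * p s) + integral\<^sup>L lborel (\<lambda>s. indicator {0<..} s * q s))"
    by (intro has_bochner_integral_add has_bochner_integral_integrable assms)
  moreover have "(\<lambda>s. indicator {0<..} s * p s + indicator {0<..} s * q s)
      = (\<lambda>s. indicator {0<..} s * (p s + q s))" by (simp add: distrib_left)
  ultimately have "I = integral\<^sup>L lborel (\<lambda>s. indicator {0<..} s * p s) + integral\<^sup>L lborel (\<lambda>s. indicator {0<..} s * q s)"
    using assms(3) by (auto dest: has_bochner_integral_eq)
  then show ?thesis
    using has_bochner_integral_add[OF has_bochner_integral_integrable[OF assms(1)] q] by simp
qed

text \<open>The contribution of the points \<open>s\<close> between \<open>0\<close> and \<open>- t\<close>, where \<open>sgn (t + s) \<noteq> sgn s\<close>.\<close>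

definition vg_remainder :: "real \<Rightarrow> real \<Rightarrow> nat \<Rightarrow> real \<Rightarrow> real" where
  "vg_remainder \<nu> b r t = 2 powr (1 - \<nu>) *
     (\<integral>s. indicator {0<..<\<bar>t\<bar>} s * ((\<bar>t\<bar> - s) ^ r * exp (- sgn t * b * s) * bessel_G \<nu> s) \<partial>lborel)"

lemma integrable_vg_remainder:
  assumes \<nu>: "\<nu> > -1/2"
  shows "integrable lborel
    (\<lambda>s. indicator {0<..<\<bar>t\<bar>} s * ((\<bar>t\<bar> - s) ^ r * exp (- sgn t * b * s) * bessel_G \<nu> s))"
proof (rule Bochner_Integration.integrable_bound)
  show "integrable lborel (\<lambda>s. (\<bar>t\<bar> ^ r * exp (\<bar>b * t\<bar>)) * (indicator {0<..} s * bessel_G \<nu> s))"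
    by (intro integrable_mult_right integrable_bessel_G \<nu>)
  show "(\<lambda>s. indicator {0<..<\<bar>t\<bar>} s * ((\<bar>t\<bar> - s) ^ r * exp (- sgn t * b * s) * bessel_G \<nu> s))
      \<in> borel_measurable lborel" by measurable
  have "(\<bar>t\<bar> - s) ^ r * exp (- sgn t * b * s) * bessel_G \<nu> s \<le> (\<bar>t\<bar> ^ r * exp (\<bar>b * t\<bar>)) * bessel_G \<nu> s"
    if s: "0 < s" "s < \<bar>t\<bar>" for s
  proof -
    have "- sgn t * b * s \<le> \<bar>- sgn t * b * s\<bar>" by (rule abs_ge_self)
    also have "\<dots> \<le> 1 * \<bar>b\<bar> * \<bar>t\<bar>"
      unfolding abs_mult using s by (intro mult_mono) (auto simp: sgn_if)
    finally have "exp (- sgn t * b * s) \<le> exp (\<bar>b * t\<bar>)" by (simp add: abs_mult)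
    then show ?thesis using s by (intro mult_mono power_mono bessel_G_nonneg) auto
  qed
  then show "AE s in lborel. norm (indicator {0<..<\<bar>t\<bar>} s * ((\<bar>t\<bar> - s) ^ r * exp (- sgn t * b * s) * bessel_G \<nu> s))
      \<le> norm ((\<bar>t\<bar> ^ r * exp (\<bar>b * t\<bar>)) * (indicator {0<..} s * bessel_G \<nu> s))"
    by (auto simp: indicator_def bessel_G_nonneg abs_mult)
qed

text \<open>The points \<open>s\<close> and \<open>- s\<close> are treated together. If
  \<open>s \<ge> \<bar>u\<bar>\<close>, replacing \<open>sgn (u + s)\<close> by \<open>sgn s\<close>
  is correct at both; if \<open>s < \<bar>u\<bar>\<close>, it is wrong at exactly one of them, the
  point \<open>- sgn u * s\<close>, and a wrong sign costs twice the power, which is the last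
  summand. In the binomial expansion the complementary exponent \<open>r - j\<close> is odd for even
  \<open>j\<close>, so that the two exponentials add up to cosh, and even for odd \<open>j\<close>,
  which gives sinh.\<close>

lemma odd_power_abs_expansion:
  fixes u s b :: real
  assumes s: "s > 0"
  shows "\<bar>u + s\<bar> ^ (2 * p + 1) * exp (b * s) + \<bar>u - s\<bar> ^ (2 * p + 1) * exp (- b * s) =
    (\<Sum>k = 0..p. real ((2 * p + 1) choose (2 * k)) * u ^ (2 * k) * (2 * (s ^ (2 * (p - k) + 1) * cosh (b * s)))
       + real ((2 * p + 1) choose (2 * k + 1)) * u ^ (2 * k + 1) * (2 * (s ^ (2 * (p - k)) * sinh (b * s))))
    + 2 * (indicator {0<..<\<bar>u\<bar>} s * ((\<bar>u\<bar> - s) ^ (2 * p + 1) * exp (- sgn u * b * s)))"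
proof -
  let ?r = "2 * p + 1"
  have neg: "(- x) ^ ?r = - (x ^ ?r)" for x :: real by simp
  have A: "\<bar>u + s\<bar> ^ ?r * exp (b * s) + \<bar>u - s\<bar> ^ ?r * exp (- b * s) =
    ((u + s) ^ ?r * exp (b * s) - (u - s) ^ ?r * exp (- b * s))
    + 2 * (indicator {0<..<\<bar>u\<bar>} s * ((\<bar>u\<bar> - s) ^ ?r * exp (- sgn u * b * s)))"
  proof -
    consider "u + s < 0" | "u - s > 0" | "u + s \<ge> 0" "u - s \<le> 0" by linarith
    then show ?thesis
    proof cases
      case 1
      then have "\<bar>u + s\<bar> = - (u + s)" "\<bar>u\<bar> - s = - (u + s)" "\<bar>u - s\<bar> = - (u - s)" "sgn u = -1" "s < \<bar>u\<bar>"
        using s by auto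
      then show ?thesis using s by (simp only: neg) simp
    next
      case 2
      then have "\<bar>u + s\<bar> = u + s" "\<bar>u\<bar> - s = u - s" "\<bar>u - s\<bar> = u - s" "sgn u = 1" "s < \<bar>u\<bar>"
        using s by auto
      then show ?thesis using s by simp
    next
      case 3
      then have "\<bar>u + s\<bar> = u + s" "\<bar>u - s\<bar> = - (u - s)" "\<not> s < \<bar>u\<bar>"
        using s by auto
      then show ?thesis by (simp only: neg) simp
    qed
  qed
  define f where "f = (\<lambda>j. real (?r choose j) * u ^ j * (s ^ (?r - j) * exp (b * s) - (- s) ^ (?r - j) * exp (- b * s)))"
  have "(u + s) ^ ?r * exp (b * s) - (u - s) ^ ?r * exp (- b * s) = (\<Sum>j\<le>?r. f j)"
  proof -
    have "(u - s) ^ ?r = (u + (- s)) ^ ?r" by simp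
    then show ?thesis
      unfolding f_def
      by (simp only: binomial_ring sum_distrib_right sum_subtractf[symmetric])
         (intro sum.cong refl, simp add: algebra_simps)
  qed
  also have "\<dots> = (\<Sum>j = 2 * 0..Suc (2 * p). f j)" by (simp add: atMost_atLeast0)
  also have "\<dots> = (\<Sum>k = 0..p. f (2 * k) + f (Suc (2 * k)))" by (rule sum.in_pairs)
  also have "\<dots> = (\<Sum>k = 0..p. real (?r choose (2 * k)) * u ^ (2 * k) * (2 * (s ^ (2 * (p - k) + 1) * cosh (b * s)))
       + real (?r choose (2 * k + 1)) * u ^ (2 * k + 1) * (2 * (s ^ (2 * (p - k)) * sinh (b * s))))"
  proof (intro sum.cong refl arg_cong2[where f = "(+)"])
    fix k assume "k \<in> {0..p}"
    then have k: "?r - 2 * k = 2 * (p - k) + 1" "?r - Suc (2 * k) = 2 * (p - k)" by auto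
    show "f (2 * k) = real (?r choose (2 * k)) * u ^ (2 * k) * (2 * (s ^ (2 * (p - k) + 1) * cosh (b * s)))"
      unfolding f_def k by (simp add: cosh_field_def algebra_simps)
    show "f (Suc (2 * k)) = real (?r choose (2 * k + 1)) * u ^ (2 * k + 1) * (2 * (s ^ (2 * (p - k)) * sinh (b * s)))"
      unfolding f_def k by (simp add: sinh_field_def algebra_simps)
  qed
  finally show ?thesis using A by simp
qed

text \<open>The folded expansion is integrated against G over the half line and then unfolded. No
  limit is involved: the polynomial part and the remainder are exact for every
  \<open>u\<close>.\<close>

lemma has_bochner_integral_vg_moment:
  assumes \<nu>: "\<nu> > -1/2" and b: "\<bar>b\<bar> < 1"
  shows "has_bochner_integral lborel (\<lambda>s. \<bar>u + s\<bar> ^ (2 * p + 1) * exp (b * s) * bessel_G \<nu> \<bar>s\<bar>)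
    ((\<Sum>k = 0..p. 2 * bessel_moment \<nu> (p - k) * u ^ (2 * k) *
        (real ((2 * p + 1) choose (2 * k)) *
           hyp2F1 (real (p - k) + 1) (\<nu> + real (p - k) + 1) (1/2) (b\<^sup>2)
       + b * u * real ((2 * p + 1) choose (2 * k + 1)) *
           hyp2F1 (real (p - k) + 1) (\<nu> + real (p - k) + 1) (3/2) (b\<^sup>2)))
     + 2 powr \<nu> * vg_remainder \<nu> b (2 * p + 1) u)"
    (is "has_bochner_integral _ _ ?I")
proof -
  let ?r = "2 * p + 1"
  define P where "P = (\<lambda>s. \<bar>u + s\<bar> ^ ?r * exp (b * s) * bessel_G \<nu> s)"
  define Q where "Q = (\<lambda>s. \<bar>u - s\<bar> ^ ?r * exp (- b * s) * bessel_G \<nu> s)"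
  have \<nu>': "\<nu> > -1" using \<nu> by simp
  \<comment> \<open>The two halves are \<open>e = 1\<close> with \<open>c = b\<close>, and
    \<open>e = -1\<close> with \<open>c = - b\<close>. Without the absolute value the power is a
    binomial sum of integrable terms, and integrability passes to absolute values.\<close>
  have half: "integrable lborel (\<lambda>s. indicator {0<..} s * (\<bar>u + e * s\<bar> ^ ?r * exp (c * s) * bessel_G \<nu> s))"
    if "\<bar>c\<bar> < 1" for c e :: real
  proof -
    have "integrable lborel (\<lambda>s. \<Sum>j\<le>?r. (real (?r choose j) * u ^ j * e ^ (?r - j)) *
        (indicator {0<..} s * ((s ^ (?r - j) * exp (c * s)) * bessel_G \<nu> s)))"
      by (intro Bochner_Integration.integrable_sum integrable_mult_right integrable_power_exp_bessel_G \<nu> that)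
    also have "(\<lambda>s. \<Sum>j\<le>?r. (real (?r choose j) * u ^ j * e ^ (?r - j)) *
        (indicator {0<..} s * ((s ^ (?r - j) * exp (c * s)) * bessel_G \<nu> s))) =
       (\<lambda>s. indicator {0<..} s * ((u + e * s) ^ ?r * exp (c * s) * bessel_G \<nu> s))"
      unfolding binomial_ring sum_distrib_left sum_distrib_right
      by (intro ext sum.cong refl) (simp add: power_mult_distrib mult_ac)
    finally have "integrable lborel (\<lambda>s. \<bar>indicator {0<..} s * ((u + e * s) ^ ?r * exp (c * s) * bessel_G \<nu> s)\<bar>)"
      by (rule integrable_abs)
    then show ?thesis by (simp add: abs_mult power_abs bessel_G_nonneg del: power_Suc)
  qed
  have intP: "integrable lborel (\<lambda>s. indicator {0<..} s * P s)"
    using half[of b 1] b by (simp add: P_def del: power_Suc)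
  have intQ: "integrable lborel (\<lambda>s. indicator {0<..} s * Q s)"
    using half[of "-b" "-1"] b by (simp add: Q_def del: power_Suc)
  define H where "H = (\<lambda>c l. hyp2F1 (real l + 1) (\<nu> + real l + 1) c (b\<^sup>2))"
  \<comment> \<open>\<open>vg_remainder\<close> carries the factor \<open>2 powr (1 - \<nu>)\<close>
    of the integral representation, which makes its leading coefficient free of powers of 2 for
    \<nu> > 0. Here that factor is taken out again.\<close>
  have rem: "has_bochner_integral lborel
      (\<lambda>s. indicator {0<..<\<bar>u\<bar>} s * ((\<bar>u\<bar> - s) ^ ?r * exp (- sgn u * b * s) * bessel_G \<nu> s))
      (2 powr (\<nu> - 1) * vg_remainder \<nu> b ?r u)"
    using has_bochner_integral_integrable[OF integrable_vg_remainder[OF \<nu>, of u ?r b]]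
    by (simp add: vg_remainder_def mult.assoc[symmetric] powr_add[symmetric])
  have "has_bochner_integral lborel (\<lambda>s.
      (\<Sum>k = 0..p. (real (?r choose (2 * k)) * u ^ (2 * k) * 2) *
          (indicator {0<..} s * ((s ^ (2 * (p - k) + 1) * cosh (b * s)) * bessel_G \<nu> s))
       + (real (?r choose (2 * k + 1)) * u ^ (2 * k + 1) * 2) *
          (indicator {0<..} s * ((s ^ (2 * (p - k)) * sinh (b * s)) * bessel_G \<nu> s)))
      + 2 * (indicator {0<..<\<bar>u\<bar>} s * ((\<bar>u\<bar> - s) ^ ?r * exp (- sgn u * b * s) * bessel_G \<nu> s)))
     ((\<Sum>k = 0..p. (real (?r choose (2 * k)) * u ^ (2 * k) * 2) * (bessel_moment \<nu> (p - k) * H (1/2) (p - k))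
       + (real (?r choose (2 * k + 1)) * u ^ (2 * k + 1) * 2) * (b * (bessel_moment \<nu> (p - k) * H (3/2) (p - k))))
      + 2 * (2 powr (\<nu> - 1) * vg_remainder \<nu> b ?r u))"
    unfolding H_def
    by (intro has_bochner_integral_add has_bochner_integral_sum has_bochner_integral_mult_right
         has_bochner_integral_cosh_bessel_G has_bochner_integral_sinh_bessel_G \<nu>' b rem)
  also have "(\<lambda>s.
      (\<Sum>k = 0..p. (real (?r choose (2 * k)) * u ^ (2 * k) * 2) *
          (indicator {0<..} s * ((s ^ (2 * (p - k) + 1) * cosh (b * s)) * bessel_G \<nu> s))
       + (real (?r choose (2 * k + 1)) * u ^ (2 * k + 1) * 2) *
          (indicator {0<..} s * ((s ^ (2 * (p - k)) * sinh (b * s)) * bessel_G \<nu> s)))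
      + 2 * (indicator {0<..<\<bar>u\<bar>} s * ((\<bar>u\<bar> - s) ^ ?r * exp (- sgn u * b * s) * bessel_G \<nu> s)))
     = (\<lambda>s. indicator {0<..} s * (P s + Q s))"
  proof
    fix s :: real
    show "(\<Sum>k = 0..p. (real (?r choose (2 * k)) * u ^ (2 * k) * 2) *
          (indicator {0<..} s * ((s ^ (2 * (p - k) + 1) * cosh (b * s)) * bessel_G \<nu> s))
       + (real (?r choose (2 * k + 1)) * u ^ (2 * k + 1) * 2) *
          (indicator {0<..} s * ((s ^ (2 * (p - k)) * sinh (b * s)) * bessel_G \<nu> s)))
      + 2 * (indicator {0<..<\<bar>u\<bar>} s * ((\<bar>u\<bar> - s) ^ ?r * exp (- sgn u * b * s) * bessel_G \<nu> s))
      = indicator {0<..} s * (P s + Q s)"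
    proof (cases "s > 0")
      case True
      have "P s + Q s = (\<bar>u + s\<bar> ^ ?r * exp (b * s) + \<bar>u - s\<bar> ^ ?r * exp (- b * s)) * bessel_G \<nu> s"
        by (simp only: P_def Q_def distrib_right)
      also have "\<dots> = (\<Sum>k = 0..p. (real (?r choose (2 * k)) * u ^ (2 * k) * 2) *
          ((s ^ (2 * (p - k) + 1) * cosh (b * s)) * bessel_G \<nu> s)
       + (real (?r choose (2 * k + 1)) * u ^ (2 * k + 1) * 2) *
          ((s ^ (2 * (p - k)) * sinh (b * s)) * bessel_G \<nu> s))
      + 2 * (indicator {0<..<\<bar>u\<bar>} s * ((\<bar>u\<bar> - s) ^ ?r * exp (- sgn u * b * s) * bessel_G \<nu> s))"
        unfolding odd_power_abs_expansion[OF True] distrib_right sum_distrib_right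
        by (simp only: mult.assoc)
      finally show ?thesis using True by (simp del: power_Suc)
    qed simp
  qed
  also have "(\<Sum>k = 0..p. (real (?r choose (2 * k)) * u ^ (2 * k) * 2) * (bessel_moment \<nu> (p - k) * H (1/2) (p - k))
       + (real (?r choose (2 * k + 1)) * u ^ (2 * k + 1) * 2) * (b * (bessel_moment \<nu> (p - k) * H (3/2) (p - k))))
      + 2 * (2 powr (\<nu> - 1) * vg_remainder \<nu> b ?r u) = ?I"
  proof -
    have "2 * (2 powr (\<nu> - 1) * vg_remainder \<nu> b ?r u) = 2 powr \<nu> * vg_remainder \<nu> b ?r u"
      by (simp add: powr_diff)
    then show ?thesis unfolding H_def
      by (intro arg_cong2[where f = "(+)"] sum.cong refl) (simp_all add: algebra_simps)
  qed
  finally have "has_bochner_integral lborel (\<lambda>s. indicator {0<..} s * P s + indicator {0<..} (- s) * Q (- s)) ?I"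
    by (rule has_bochner_integral_two_sided[OF intP intQ])
  also have "(\<lambda>s. indicator {0<..} s * P s + indicator {0<..} (- s) * Q (- s)) =
      (\<lambda>s. \<bar>u + s\<bar> ^ ?r * exp (b * s) * bessel_G \<nu> \<bar>s\<bar>)"
  proof
    fix s :: real
    \<comment> \<open>At \<open>s = 0\<close> both sides vanish, because
      \<open>0 powr \<nu> = 0\<close> makes \<open>bessel_G \<nu> 0\<close> equal to 0.\<close>
    consider "s > 0" | "s < 0" | "s = 0" by linarith
    then show "indicator {0<..} s * P s + indicator {0<..} (- s) * Q (- s) =
        \<bar>u + s\<bar> ^ ?r * exp (b * s) * bessel_G \<nu> \<bar>s\<bar>"
      by cases (auto simp: P_def Q_def bessel_G_def)
  qed
  finally show ?thesis .
qed

text \<open>Of the factor \<open>\<alpha> powr (2 * \<nu> + 1)\<close> in the normalising constant,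
  one \<open>\<alpha> powr \<nu>\<close> cancels against \<open>(2 * \<alpha>) powr \<nu>\<close>
  and one against \<open>\<bar>s / \<alpha>\<bar> powr \<nu>\<close>. The surviving \<alpha> will be
  absorbed by the Jacobian, so that apart from it only \<open>\<beta> / \<alpha>\<close> is
  left.\<close>

lemma vg_density_scaled:
  assumes \<alpha>: "\<bar>\<beta>\<bar> < \<alpha>"
  shows "vg_density \<nu> \<alpha> \<beta> \<mu> (\<mu> + 1 / \<alpha> * s) =
    \<alpha> * (1 - \<beta>\<^sup>2 / \<alpha>\<^sup>2) powr (\<nu> + 1/2) / (sqrt pi * 2 powr \<nu> * Gamma (\<nu> + 1/2)) *
      (exp (\<beta> / \<alpha> * s) * bessel_G \<nu> \<bar>s\<bar>)"
proof -
  have a: "\<alpha> > 0" using \<alpha> by linarith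
  have "\<beta>\<^sup>2 < \<alpha>\<^sup>2" using power_strict_mono[OF \<alpha> abs_ge_zero, of 2] by simp
  then have pos: "0 < 1 - \<beta>\<^sup>2 / \<alpha>\<^sup>2" using a by (simp add: field_simps)
  have "\<alpha>\<^sup>2 - \<beta>\<^sup>2 = \<alpha>\<^sup>2 * (1 - \<beta>\<^sup>2 / \<alpha>\<^sup>2)" using a by (simp add: field_simps)
  then have "(\<alpha>\<^sup>2 - \<beta>\<^sup>2) powr (\<nu> + 1/2) = (\<alpha>\<^sup>2) powr (\<nu> + 1/2) * (1 - \<beta>\<^sup>2 / \<alpha>\<^sup>2) powr (\<nu> + 1/2)"
    using a pos by (simp add: powr_mult)
  also have "(\<alpha>\<^sup>2) powr (\<nu> + 1/2) = \<alpha> * \<alpha> powr \<nu> * \<alpha> powr \<nu>"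
  proof -
    have "(\<alpha>\<^sup>2) powr (\<nu> + 1/2) = \<alpha> powr (2 * (\<nu> + 1/2))"
      using a by (simp add: powr_numeral[symmetric] powr_powr del: powr_numeral)
    also have "2 * (\<nu> + 1/2) = 1 + \<nu> + \<nu>" by simp
    finally show ?thesis using a by (simp only: powr_add powr_one)
  qed
  finally have P: "(\<alpha>\<^sup>2 - \<beta>\<^sup>2) powr (\<nu> + 1/2) = \<alpha> * \<alpha> powr \<nu> * \<alpha> powr \<nu> * (1 - \<beta>\<^sup>2 / \<alpha>\<^sup>2) powr (\<nu> + 1/2)" .
  have "\<alpha> powr \<nu> > 0" using a by simp
  have abs: "\<bar>1 / \<alpha> * s\<bar> = \<bar>s\<bar> / \<alpha>" using a by (simp add: abs_mult)
  have K: "\<alpha> * (\<bar>s\<bar> / \<alpha>) = \<bar>s\<bar>" using a by simp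
  show ?thesis
    unfolding vg_density_def add_diff_cancel_left' P abs K bessel_G_def
    using a \<open>\<alpha> powr \<nu> > 0\<close> by (simp add: powr_divide powr_mult field_simps)
qed

lemma vg_density_nonneg: "\<nu> > -1/2 \<Longrightarrow> \<alpha> \<ge> 0 \<Longrightarrow> vg_density \<nu> \<alpha> \<beta> \<mu> x \<ge> 0"
  by (auto simp: vg_density_def bessel_K_nonneg intro!: mult_nonneg_nonneg divide_nonneg_nonneg Gamma_real_nonneg)

text \<open>An exact identity for each \<mu>; asymptotics will enter through
  \<open>vg_remainder\<close> alone.\<close>

lemma vg_absolute_moment:
  assumes \<nu>: "\<nu> > -1/2" and \<alpha>: "\<bar>\<beta>\<bar> < \<alpha>" and r: "r = 2 * p + 1"
    and D: "prob_space M" "distributed M lborel X (\<lambda>x. ennreal (vg_density \<nu> \<alpha> \<beta> \<mu> x))"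
  shows "integrable M (\<lambda>\<omega>. \<bar>X \<omega>\<bar> ^ r)" (is ?int)
    and "prob_space.expectation M (\<lambda>\<omega>. \<bar>X \<omega>\<bar> ^ r) =
        2 ^ r * (1 - \<beta>\<^sup>2 / \<alpha>\<^sup>2) powr (\<nu> + 1/2) / (sqrt pi * \<alpha> ^ r * Gamma (\<nu> + 1/2)) *
        ((\<Sum>k = 0..p.
            (\<alpha> * \<mu> / 2) ^ (2 * k) *
            Gamma ((real r - 2 * real k + 1) / 2) *
            Gamma (\<nu> + (real r - 2 * real k + 1) / 2) *
            (real (r choose (2 * k)) *
               hyp2F1 ((real r - 2 * real k + 1) / 2) (\<nu> + (real r - 2 * real k + 1) / 2)
                 (1/2) (\<beta>\<^sup>2 / \<alpha>\<^sup>2)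
             + \<beta> / \<alpha> * (\<alpha> * \<mu>) * real (r choose (2 * k + 1)) *
               hyp2F1 ((real r - 2 * real k + 1) / 2) (\<nu> + (real r - 2 * real k + 1) / 2)
                 (3/2) (\<beta>\<^sup>2 / \<alpha>\<^sup>2)))
         + vg_remainder \<nu> (\<beta> / \<alpha>) r (\<alpha> * \<mu>) / 2 ^ r)" (is "_ = ?E")
proof -
  interpret prob_space M by fact
  have a: "\<alpha> > 0" using \<alpha> by linarith
  define b u where "b = \<beta> / \<alpha>" and "u = \<alpha> * \<mu>"
  define c where "c = (1 - \<beta>\<^sup>2 / \<alpha>\<^sup>2) powr (\<nu> + 1/2) / (sqrt pi * 2 powr \<nu> * Gamma (\<nu> + 1/2))"
  have b: "\<bar>b\<bar> < 1" "b\<^sup>2 = \<beta>\<^sup>2 / \<alpha>\<^sup>2" using \<alpha> a by (auto simp: b_def power_divide)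
  define S where "S = (\<Sum>k = 0..p. 2 * bessel_moment \<nu> (p - k) * u ^ (2 * k) *
        (real (r choose (2 * k)) *
           hyp2F1 (real (p - k) + 1) (\<nu> + real (p - k) + 1) (1/2) (b\<^sup>2)
       + b * u * real (r choose (2 * k + 1)) *
           hyp2F1 (real (p - k) + 1) (\<nu> + real (p - k) + 1) (3/2) (b\<^sup>2)))"
  have "has_bochner_integral lborel (\<lambda>s. (\<alpha> * c / \<alpha> ^ r) * (\<bar>u + s\<bar> ^ r * exp (b * s) * bessel_G \<nu> \<bar>s\<bar>))
      ((\<alpha> * c / \<alpha> ^ r) * (S + 2 powr \<nu> * vg_remainder \<nu> b r u))"
    unfolding S_def r by (intro has_bochner_integral_mult_right has_bochner_integral_vg_moment \<nu> b)
  also have "(\<lambda>s. (\<alpha> * c / \<alpha> ^ r) * (\<bar>u + s\<bar> ^ r * exp (b * s) * bessel_G \<nu> \<bar>s\<bar>)) =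
      (\<lambda>s. vg_density \<nu> \<alpha> \<beta> \<mu> (\<mu> + 1 / \<alpha> * s) * \<bar>\<mu> + 1 / \<alpha> * s\<bar> ^ r)"
  proof
    fix s
    have "\<mu> + 1 / \<alpha> * s = (u + s) / \<alpha>" using a by (simp add: u_def field_simps)
    then have "\<bar>\<mu> + 1 / \<alpha> * s\<bar> ^ r = \<bar>u + s\<bar> ^ r / \<alpha> ^ r" using a by (simp add: power_divide)
    then show "(\<alpha> * c / \<alpha> ^ r) * (\<bar>u + s\<bar> ^ r * exp (b * s) * bessel_G \<nu> \<bar>s\<bar>) =
        vg_density \<nu> \<alpha> \<beta> \<mu> (\<mu> + 1 / \<alpha> * s) * \<bar>\<mu> + 1 / \<alpha> * s\<bar> ^ r"
      unfolding vg_density_scaled[OF \<alpha>] b_def c_def by simp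
  qed
  \<comment> \<open>The factor \<alpha> of the scaled density is written as division by the Jacobian
    \<open>1 / \<alpha>\<close>, the form in which the affine change of variables is read
    backwards.\<close>
  also have "(\<alpha> * c / \<alpha> ^ r) * (S + 2 powr \<nu> * vg_remainder \<nu> b r u) =
     ((c / \<alpha> ^ r) * (S + 2 powr \<nu> * vg_remainder \<nu> b r u)) /\<^sub>R \<bar>1 / \<alpha>\<bar>"
    using a by simp
  finally have hb: "has_bochner_integral lborel (\<lambda>x. vg_density \<nu> \<alpha> \<beta> \<mu> x * \<bar>x\<bar> ^ r)
      ((c / \<alpha> ^ r) * (S + 2 powr \<nu> * vg_remainder \<nu> b r u))"
    using a by (subst lborel_has_bochner_integral_real_affine_iff[where c = "1 / \<alpha>" and t = \<mu>]) auto
  have nn: "\<And>x. x \<in> space lborel \<Longrightarrow> 0 \<le> vg_density \<nu> \<alpha> \<beta> \<mu> x"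
    using \<nu> a by (intro vg_density_nonneg) auto
  show ?int
    using distributed_integrable[OF D(2) _ nn, of "\<lambda>x. \<bar>x\<bar> ^ r"] hb by (simp add: has_bochner_integral_iff)
  have "expectation (\<lambda>\<omega>. \<bar>X \<omega>\<bar> ^ r) = (c / \<alpha> ^ r) * (S + 2 powr \<nu> * vg_remainder \<nu> b r u)"
    using distributed_integral[OF D(2) _ nn, of "\<lambda>x. \<bar>x\<bar> ^ r"] hb by (simp add: has_bochner_integral_iff)
  also have "S = 2 ^ r * 2 powr \<nu> * (\<Sum>k = 0..p.
            (u / 2) ^ (2 * k) *
            Gamma ((real r - 2 * real k + 1) / 2) *
            Gamma (\<nu> + (real r - 2 * real k + 1) / 2) *
            (real (r choose (2 * k)) *
               hyp2F1 ((real r - 2 * real k + 1) / 2) (\<nu> + (real r - 2 * real k + 1) / 2)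
                 (1/2) (\<beta>\<^sup>2 / \<alpha>\<^sup>2)
             + b * u * real (r choose (2 * k + 1)) *
               hyp2F1 ((real r - 2 * real k + 1) / 2) (\<nu> + (real r - 2 * real k + 1) / 2)
                 (3/2) (\<beta>\<^sup>2 / \<alpha>\<^sup>2)))"
    unfolding S_def sum_distrib_left
  proof (intro sum.cong refl)
    fix k assume k: "k \<in> {0..p}"
    have e: "(real r - 2 * real k + 1) / 2 = real (p - k) + 1"
      using k by (simp add: r field_simps of_nat_diff)
    \<comment> \<open>Since \<open>r = 2 * (p - k) + 2 * k + 1\<close>, the powers of 2 coming from
      the moment, from the doubling and from \<open>(u / 2) ^ (2 * k)\<close> combine to
      \<open>2 ^ r\<close> for every \<open>k\<close>. Pulling this common factor out of the braces
      is what divides the remainder by \<open>2 ^ r\<close>.\<close>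
    have "2 * bessel_moment \<nu> (p - k) * u ^ (2 * k) = 
      2 * (2 powr \<nu> * 2 ^ (2 * (p - k))) * u ^ (2 * k) * (Gamma (real (p - k) + 1) * Gamma (\<nu> + real (p - k) + 1))"
      unfolding bessel_moment_def Gamma_fact[symmetric]
      using powr_realpow[of 2 "2 * (p - k)"] by (simp add: powr_add add_ac)
    also have "2 * (2 powr \<nu> * 2 ^ (2 * (p - k))) * u ^ (2 * k) = 2 ^ r * 2 powr \<nu> * (u / 2) ^ (2 * k)"
    proof -
      have "(2::real) ^ r = 2 * (2 ^ (2 * (p - k)) * 2 ^ (2 * k))"
        using k by (simp add: r power_add[symmetric] algebra_simps)
      then show ?thesis by (simp add: power_divide)
    qed
    finally have f: "2 * bessel_moment \<nu> (p - k) * u ^ (2 * k) = 2 ^ r * 2 powr \<nu> * (u / 2) ^ (2 * k)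
        * (Gamma (real (p - k) + 1) * Gamma (\<nu> + real (p - k) + 1))" .
    show "2 * bessel_moment \<nu> (p - k) * u ^ (2 * k) *
        (real (r choose (2 * k)) *
           hyp2F1 (real (p - k) + 1) (\<nu> + real (p - k) + 1) (1/2) (b\<^sup>2)
       + b * u * real (r choose (2 * k + 1)) *
           hyp2F1 (real (p - k) + 1) (\<nu> + real (p - k) + 1) (3/2) (b\<^sup>2)) = 
       2 ^ r * 2 powr \<nu> * ((u / 2) ^ (2 * k) *
            Gamma ((real r - 2 * real k + 1) / 2) *
            Gamma (\<nu> + (real r - 2 * real k + 1) / 2) *
            (real (r choose (2 * k)) *
               hyp2F1 ((real r - 2 * real k + 1) / 2) (\<nu> + (real r - 2 * real k + 1) / 2)
                 (1/2) (\<beta>\<^sup>2 / \<alpha>\<^sup>2)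
             + b * u * real (r choose (2 * k + 1)) *
               hyp2F1 ((real r - 2 * real k + 1) / 2) (\<nu> + (real r - 2 * real k + 1) / 2)
                 (3/2) (\<beta>\<^sup>2 / \<alpha>\<^sup>2)))"
      unfolding f e b(2) by (simp only: mult.assoc add.assoc)
  qed
  also have "c / \<alpha> ^ r * (2 ^ r * 2 powr \<nu> * T + 2 powr \<nu> * R) =
      2 ^ r * (1 - \<beta>\<^sup>2 / \<alpha>\<^sup>2) powr (\<nu> + 1/2) / (sqrt pi * \<alpha> ^ r * Gamma (\<nu> + 1/2)) * (T + R / 2 ^ r)" for T R
    unfolding c_def by (simp add: distrib_left) (simp add: mult_ac)
  finally show "expectation (\<lambda>\<omega>. \<bar>X \<omega>\<bar> ^ r) = ?E"
    unfolding b_def u_def .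
qed

text \<open>Scaling by \<open>\<bar>t\<bar>\<close> moves the integral to a fixed interval, leaving
  \<open>t\<close> only in the exponential and in the argument of G. The sign survives in the
  exponential alone, as \<open>sgn t * \<bar>t\<bar> = t\<close>.\<close>

lemma vg_remainder_rescaled:
  assumes t: "t \<noteq> 0"
  shows "vg_remainder \<nu> b r t = \<bar>t\<bar> ^ (r + 1) *
    (\<integral>x. indicator {0<..<1} x * ((1 - x) ^ r *
        (exp (- b * t * x) * (2 powr (1 - \<nu>) * bessel_G \<nu> (\<bar>t\<bar> * x)))) \<partial>lborel)"
proof -
  have "(\<integral>s. indicator {0<..<\<bar>t\<bar>} s * ((\<bar>t\<bar> - s) ^ r * exp (- sgn t * b * s) * bessel_G \<nu> s) \<partial>lborel)
     = \<bar>t\<bar> * (\<integral>x. indicator {0<..<\<bar>t\<bar>} (\<bar>t\<bar> * x) *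
         ((\<bar>t\<bar> - \<bar>t\<bar> * x) ^ r * exp (- sgn t * b * (\<bar>t\<bar> * x)) * bessel_G \<nu> (\<bar>t\<bar> * x)) \<partial>lborel)"
    using t by (subst lborel_integral_real_affine[where c = "\<bar>t\<bar>" and t = 0]) auto
  also have "\<dots> = \<bar>t\<bar> * (\<integral>x. \<bar>t\<bar> ^ r * (indicator {0<..<1} x *
        ((1 - x) ^ r * (exp (- b * t * x) * bessel_G \<nu> (\<bar>t\<bar> * x)))) \<partial>lborel)"
  proof (rule arg_cong[where f = "(*) \<bar>t\<bar>"], rule Bochner_Integration.integral_cong)
    fix x :: real
    have "indicator {0<..<\<bar>t\<bar>} (\<bar>t\<bar> * x) = (indicator {0<..<1} x :: real)"
      using t by (auto simp: indicator_def zero_less_mult_iff)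
    moreover have "(\<bar>t\<bar> - \<bar>t\<bar> * x) ^ r = \<bar>t\<bar> ^ r * (1 - x) ^ r"
      by (simp add: power_mult_distrib[symmetric] right_diff_distrib)
    moreover have "- sgn t * b * (\<bar>t\<bar> * x) = - b * t * x"
      by (simp add: sgn_if)
    ultimately show "indicator {0<..<\<bar>t\<bar>} (\<bar>t\<bar> * x) *
         ((\<bar>t\<bar> - \<bar>t\<bar> * x) ^ r * exp (- sgn t * b * (\<bar>t\<bar> * x)) * bessel_G \<nu> (\<bar>t\<bar> * x)) =
       \<bar>t\<bar> ^ r * (indicator {0<..<1} x * ((1 - x) ^ r * (exp (- b * t * x) * bessel_G \<nu> (\<bar>t\<bar> * x))))"
      by (simp only: mult_ac)
  qed simp
  finally show ?thesis
    unfolding vg_remainder_def by (simp add: mult_ac integral_mult_right_zero[symmetric] del: integral_mult_right_zero)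
qed

lemma integrable_bessel_G_rescaled:
  assumes \<nu>: "\<nu> > -1/2" and t: "t \<noteq> 0"
  shows "integrable lborel (\<lambda>x. indicator {0<..<1} x * ((1 - x) ^ r *
        (exp (- b * t * x) * (2 powr (1 - \<nu>) * bessel_G \<nu> (\<bar>t\<bar> * x)))))"
proof (rule Bochner_Integration.integrable_bound)
  have "integrable lborel (\<lambda>x. indicator {0<..} (0 + \<bar>t\<bar> * x) * bessel_G \<nu> (0 + \<bar>t\<bar> * x))"
    using t by (intro lborel_integrable_real_affine integrable_bessel_G \<nu>) auto
  then show "integrable lborel (\<lambda>x. (exp \<bar>b * t\<bar> * 2 powr (1 - \<nu>)) *
      (indicator {0<..} (\<bar>t\<bar> * x) * bessel_G \<nu> (\<bar>t\<bar> * x)))"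
    by (intro integrable_mult_right) simp
  show "(\<lambda>x. indicator {0<..<1} x * ((1 - x) ^ r *
        (exp (- b * t * x) * (2 powr (1 - \<nu>) * bessel_G \<nu> (\<bar>t\<bar> * x))))) \<in> borel_measurable lborel"
    by measurable
  have "(1 - x) ^ r * (exp (- b * t * x) * (2 powr (1 - \<nu>) * bessel_G \<nu> (\<bar>t\<bar> * x)))
     \<le> 1 * (exp \<bar>b * t\<bar> * (2 powr (1 - \<nu>) * bessel_G \<nu> (\<bar>t\<bar> * x)))" if x: "0 < x" "x < 1" for x
  proof -
    have "- b * t * x \<le> \<bar>- b * t * x\<bar>" by (rule abs_ge_self)
    also have "\<dots> \<le> \<bar>b * t\<bar> * 1" unfolding abs_mult using x by (intro mult_mono) auto
    finally show ?thesis using x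
      by (intro mult_mono) (auto intro!: power_le_one bessel_G_nonneg mult_nonneg_nonneg)
  qed
  then show "AE x in lborel. norm (indicator {0<..<1} x * ((1 - x) ^ r *
        (exp (- b * t * x) * (2 powr (1 - \<nu>) * bessel_G \<nu> (\<bar>t\<bar> * x)))))
     \<le> norm ((exp \<bar>b * t\<bar> * 2 powr (1 - \<nu>)) * (indicator {0<..} (\<bar>t\<bar> * x) * bessel_G \<nu> (\<bar>t\<bar> * x)))"
    using t by (auto simp: indicator_def bessel_G_nonneg abs_mult zero_less_mult_iff mult.assoc)
qed

text \<open>Common reduction of the three ranges of \<nu>: \<open>m\<close> is the model that
  replaces G together with its exponential, and the weight \<open>(1 - x) ^ r \<le> 1\<close> is
  dropped from the error. The bound \<open>w\<close> may depend on \<open>x\<close>, since for \<nu>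
  = 0 the error is a logarithm of \<open>x\<close>, integrable but unbounded.\<close>

lemma vg_remainder_approx:
  assumes \<nu>: "\<nu> > -1/2" and t: "t \<noteq> 0"
    and m: "integrable lborel (\<lambda>x. indicator {0<..<1} x * ((1 - x) ^ r * m x))"
    and w: "integrable lborel (\<lambda>x. indicator {0<..<1} x * w x)"
    and le: "\<And>x. 0 < x \<Longrightarrow> x < 1 \<Longrightarrow>
       \<bar>exp (- b * t * x) * (2 powr (1 - \<nu>) * bessel_G \<nu> (\<bar>t\<bar> * x)) - m x\<bar> \<le> w x"
  shows "\<bar>vg_remainder \<nu> b r t - \<bar>t\<bar> ^ (r + 1) * (\<integral>x. indicator {0<..<1} x * ((1 - x) ^ r * m x) \<partial>lborel)\<bar>
    \<le> \<bar>t\<bar> ^ (r + 1) * (\<integral>x. indicator {0<..<1} x * w x \<partial>lborel)"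
proof -
  let ?f = "\<lambda>x. exp (- b * t * x) * (2 powr (1 - \<nu>) * bessel_G \<nu> (\<bar>t\<bar> * x))"
  let ?i = "\<lambda>x::real. indicator {0<..<1} x :: real"
  note f = integrable_bessel_G_rescaled[OF \<nu> t, of r b]
  have "vg_remainder \<nu> b r t - \<bar>t\<bar> ^ (r + 1) * (\<integral>x. ?i x * ((1 - x) ^ r * m x) \<partial>lborel)
     = \<bar>t\<bar> ^ (r + 1) * (\<integral>x. ?i x * ((1 - x) ^ r * ?f x) - ?i x * ((1 - x) ^ r * m x) \<partial>lborel)"
    unfolding vg_remainder_rescaled[OF t] Bochner_Integration.integral_diff[OF f m]
    by (simp only: right_diff_distrib)
  moreover have "\<bar>\<integral>x. ?i x * ((1 - x) ^ r * ?f x) - ?i x * ((1 - x) ^ r * m x) \<partial>lborel\<bar>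
     \<le> (\<integral>x. ?i x * w x \<partial>lborel)"
  proof -
    have "\<bar>\<integral>x. ?i x * ((1 - x) ^ r * ?f x) - ?i x * ((1 - x) ^ r * m x) \<partial>lborel\<bar>
       \<le> (\<integral>x. \<bar>?i x * ((1 - x) ^ r * ?f x) - ?i x * ((1 - x) ^ r * m x)\<bar> \<partial>lborel)"
      by (rule integral_abs_bound)
    also have "\<dots> \<le> (\<integral>x. ?i x * w x \<partial>lborel)"
    proof (rule integral_mono)
      show "integrable lborel (\<lambda>x. \<bar>?i x * ((1 - x) ^ r * ?f x) - ?i x * ((1 - x) ^ r * m x)\<bar>)"
        by (intro integrable_abs Bochner_Integration.integrable_diff f m)
      show "\<bar>?i x * ((1 - x) ^ r * ?f x) - ?i x * ((1 - x) ^ r * m x)\<bar> \<le> ?i x * w x" for x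
      proof (cases "x \<in> {0<..<1}")
        case True
        then have "\<bar>(1 - x) ^ r * ?f x - (1 - x) ^ r * m x\<bar> = (1 - x) ^ r * \<bar>?f x - m x\<bar>"
          by (simp only: right_diff_distrib[symmetric] abs_mult) (simp add: power_abs)
        also have "\<dots> \<le> 1 * w x" using True le[of x] by (intro mult_mono power_le_one) auto
        finally show ?thesis using True by simp
      qed simp
    qed (fact w)
    finally show ?thesis .
  qed
  ultimately show ?thesis by (simp add: abs_mult mult_left_mono)
qed

section \<open>Asymptotics of the remainder\<close>

text \<open>Turns a pointwise comparison of integrands, with main part \<open>g\<close> and error
  \<open>h\<close>, into an inequality of real numbers once all three integrals are known to be
  finite.\<close>

lemma nn_integral_real_le:
  fixes f g h :: "real \<Rightarrow> real"
  assumes [measurable]: "g \<in> borel_measurable borel" "h \<in> borel_measurable borel"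
    and "(\<integral>\<^sup>+v. ennreal (indicator {0<..} v * f v) \<partial>lborel) = ennreal F"
    and "(\<integral>\<^sup>+v. ennreal (indicator {0<..} v * g v) \<partial>lborel) = ennreal G" "G \<ge> 0"
    and "(\<integral>\<^sup>+v. ennreal (indicator {0<..} v * h v) \<partial>lborel) = ennreal H" "H \<ge> 0"
    and nn: "\<And>v. v > 0 \<Longrightarrow> g v \<ge> 0" "\<And>v. v > 0 \<Longrightarrow> h v \<ge> 0"
    and le: "\<And>v. v > 0 \<Longrightarrow> f v \<le> g v + h v"
  shows "F \<le> G + H"
proof -
  have "ennreal F \<le> (\<integral>\<^sup>+v. ennreal (indicator {0<..} v * g v) + ennreal (indicator {0<..} v * h v) \<partial>lborel)"
    unfolding assms(3)[symmetric]
  proof (rule nn_integral_mono)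
    fix v :: real
    show "ennreal (indicator {0<..} v * f v) \<le> ennreal (indicator {0<..} v * g v) + ennreal (indicator {0<..} v * h v)"
      using nn[of v] le[of v]
      by (cases "v > 0") (auto simp: ennreal_plus[symmetric] intro!: ennreal_leI simp del: ennreal_plus)
  qed
  also have "\<dots> = ennreal (G + H)"
    using assms by (subst nn_integral_add) auto
  finally show ?thesis using assms by (subst (asm) ennreal_le_iff) auto
qed

section \<open>Behaviour of G at the origin\<close>

lemma one_minus_exp_le_powr:
  fixes x \<theta> :: real
  assumes "x > 0" "0 < \<theta>" "\<theta> \<le> 1"
  shows "1 - exp (- x) \<le> x powr \<theta>"
proof (cases "x \<le> 1")
  case True
  have "1 - exp (- x) \<le> x" using exp_ge_add_one_self[of "- x"] by linarith
  also have "x = x powr 1" using assms by simp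
  also have "\<dots> \<le> x powr \<theta>" using assms True by (intro powr_mono') auto
  finally show ?thesis .
next
  case False
  have "1 - exp (- x) \<le> 1" by simp
  also have "\<dots> \<le> x powr \<theta>" using assms False by (intro ge_one_powr_ge_zero) auto
  finally show ?thesis .
qed

text \<open>Dropping \<open>exp (- x)\<close> with \<open>x = y\<^sup>2 / (4 * v)\<close> costs
  \<open>1 - exp (- x) \<le> x powr \<theta>\<close>. The linear bound would cost a full power of
  \<open>v\<close> and make the Gamma integral diverge for \<nu> \<le> 1; the fractional one costs
  only \<open>v powr \<theta>\<close>, which is affordable as \<theta> < \<nu>.\<close>

lemma bessel_G_near_0_pos:
  assumes \<theta>: "0 < \<theta>" "\<theta> \<le> 1" "\<theta> < \<nu>" and y: "y > 0"
  shows "\<bar>2 powr (1 - \<nu>) * bessel_G \<nu> y - Gamma \<nu>\<bar> \<le> (y\<^sup>2 / 4) powr \<theta> * Gamma (\<nu> - \<theta>)"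
proof -
  define x where "x = (\<lambda>v. y\<^sup>2 / (4 * v))"
  have \<nu>: "\<nu> > -1" "\<nu> > 0" using \<theta> by auto
  note rep = bessel_G_integral_representation[OF \<nu>(1) y]
  have g0: "(\<integral>\<^sup>+v. ennreal (indicator {0<..} v * (v powr (\<nu> - 1) * exp (- 1 * v))) \<partial>lborel) = ennreal (Gamma \<nu>)"
    using nn_integral_Gamma_scaled[of \<nu> 1] \<nu> by simp
  have g1: "(\<integral>\<^sup>+v. ennreal (indicator {0<..} v * ((y\<^sup>2 / 4) powr \<theta> * (v powr (\<nu> - \<theta> - 1) * exp (- 1 * v)))) \<partial>lborel)
       = ennreal ((y\<^sup>2 / 4) powr \<theta> * Gamma (\<nu> - \<theta>))"
  proof -
    have "(\<integral>\<^sup>+v. ennreal (indicator {0<..} v * ((y\<^sup>2 / 4) powr \<theta> * (v powr (\<nu> - \<theta> - 1) * exp (- 1 * v)))) \<partial>lborel)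
      = (\<integral>\<^sup>+v. ennreal ((y\<^sup>2 / 4) powr \<theta>) * ennreal (indicator {0<..} v * (v powr (\<nu> - \<theta> - 1) * exp (- 1 * v))) \<partial>lborel)"
      by (intro nn_integral_cong) (simp add: ennreal_mult'[symmetric] mult_ac)
    also have "\<dots> = ennreal ((y\<^sup>2 / 4) powr \<theta>) * ennreal (Gamma (\<nu> - \<theta>) / 1 powr (\<nu> - \<theta>))"
      by (subst nn_integral_cmult, measurable) (subst nn_integral_Gamma_scaled, use \<theta> in auto)
    finally show ?thesis by (simp add: ennreal_mult')
  qed
  have up: "2 powr (1 - \<nu>) * bessel_G \<nu> y \<le> Gamma \<nu> + 0"
    by (rule nn_integral_real_le[OF _ _ rep g0, where h = "\<lambda>_. 0"])
       (use \<nu> in \<open>auto intro!: mult_left_mono\<close>)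
  have lo: "Gamma \<nu> \<le> 2 powr (1 - \<nu>) * bessel_G \<nu> y + (y\<^sup>2 / 4) powr \<theta> * Gamma (\<nu> - \<theta>)"
  proof (rule nn_integral_real_le[OF _ _ g0 rep _ g1])
    fix v :: real assume v: "v > 0"
    have "x v powr \<theta> = (y\<^sup>2 / 4) powr \<theta> / v powr \<theta>"
      using v y unfolding x_def by (subst powr_divide[symmetric]) (auto simp: field_simps)
    moreover have "v powr (\<nu> - \<theta> - 1) = v powr (\<nu> - 1) / v powr \<theta>"
      by (subst powr_diff[symmetric]) (simp add: algebra_simps)
    ultimately have e: "v powr (\<nu> - 1) * exp (- v) * x v powr \<theta>
        = (y\<^sup>2 / 4) powr \<theta> * (v powr (\<nu> - \<theta> - 1) * exp (- 1 * v))"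
      by simp
    have "v powr (\<nu> - 1) * exp (- v) * (1 - exp (- x v)) \<le> v powr (\<nu> - 1) * exp (- v) * x v powr \<theta>"
      using v y \<theta> by (intro mult_left_mono one_minus_exp_le_powr) (auto simp: x_def)
    moreover have "exp (- v - x v) = exp (- v) * exp (- x v)" by (simp only: diff_conv_add_uminus exp_add)
    ultimately show "v powr (\<nu> - 1) * exp (- 1 * v) \<le> v powr (\<nu> - 1) * exp (- v - y\<^sup>2 / (4 * v))
       + (y\<^sup>2 / 4) powr \<theta> * (v powr (\<nu> - \<theta> - 1) * exp (- 1 * v))"
      unfolding e[symmetric] x_def by (simp add: algebra_simps)
  qed (use \<theta> in \<open>auto simp: bessel_G_nonneg\<close>)
  from up lo show ?thesis by linarith
qed

text \<open>Without the factor \<open>exp (- v)\<close>, inversion of \<open>v\<close> yields a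
  Gamma integral of rate \<open>y\<^sup>2 / 4\<close>, hence the power
  \<open>y powr (2 * \<nu>)\<close>. The loss is at most the integral of
  \<open>v powr (\<nu> - 1) * (1 - exp (- v))\<close>, which is independent of \<open>y\<close> and
  converges at 0 because \<nu> > -1 and at infinity because \<nu> < 0.\<close>

lemma bessel_G_near_0_neg:
  assumes \<nu>: "-1 < \<nu>" "\<nu> < 0"
  shows "\<exists>C\<ge>0. \<forall>y>0.
    \<bar>2 powr (1 - \<nu>) * bessel_G \<nu> y - 2 powr (- 2 * \<nu>) * Gamma (- \<nu>) * y powr (2 * \<nu>)\<bar> \<le> C"
proof -
  let ?D = "\<integral>\<^sup>+v. ennreal (indicator {0<..} v * (v powr (\<nu> - 1) * (1 - exp (- v)))) \<partial>lborel"
  have "?D \<le> (\<integral>\<^sup>+v. ennreal (v powr \<nu>) * indicator {0..1} v + ennreal (v powr (\<nu> - 1)) * indicator {1..} v \<partial>lborel)"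
  proof (rule nn_integral_mono)
    fix v :: real
    have small: "v powr (\<nu> - 1) * (1 - exp (- v)) \<le> v powr \<nu>" if "v > 0"
    proof -
      have "1 - exp (- v) \<le> v" using exp_ge_add_one_self[of "- v"] by linarith
      then have "v powr (\<nu> - 1) * (1 - exp (- v)) \<le> v powr (\<nu> - 1) * v" by (intro mult_left_mono) auto
      then show ?thesis using that by (simp add: powr_diff)
    qed
    have large: "v powr (\<nu> - 1) * (1 - exp (- v)) \<le> v powr (\<nu> - 1)"
      using mult_left_mono[of "1 - exp (- v)" 1 "v powr (\<nu> - 1)"] by simp
    consider "v \<le> 0" | "0 < v" "v \<le> 1" | "1 < v" by linarith
    then show "ennreal (indicator {0<..} v * (v powr (\<nu> - 1) * (1 - exp (- v)))) \<le>
        ennreal (v powr \<nu>) * indicator {0..1} v + ennreal (v powr (\<nu> - 1)) * indicator {1..} v"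
    proof cases
      case 2
      then have "ennreal (indicator {0<..} v * (v powr (\<nu> - 1) * (1 - exp (- v)))) \<le>
          ennreal (v powr \<nu>) * indicator {0..1} v"
        using small by (simp add: ennreal_leI)
      then show ?thesis by (rule add_increasing2[rotated]) simp
    next
      case 3
      then have "ennreal (indicator {0<..} v * (v powr (\<nu> - 1) * (1 - exp (- v)))) \<le>
          ennreal (v powr (\<nu> - 1)) * indicator {1..} v"
        using large by (simp add: ennreal_leI)
      then show ?thesis by (rule add_increasing[rotated]) simp
    qed simp
  qed
  also have "\<dots> = ennreal (1 powr (\<nu> + 1) / (\<nu> + 1)) + ennreal (- (1 powr (\<nu> - 1 + 1)) / (\<nu> - 1 + 1))"
    using \<nu> by (subst nn_integral_add)
      (auto intro!: arg_cong2[where f = "(+)"] nn_integral_has_integral_lebesgue' has_integral_powr_from_0[of \<nu> 1, simplified]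
           has_integral_powr_to_inf[of "\<nu> - 1" 1, simplified])
  also have "\<dots> < top" by simp
  finally have D: "ennreal (enn2real ?D) = ?D" by simp
  show ?thesis
  proof (intro exI[of _ "enn2real ?D"] conjI allI impI)
    fix y :: real assume y: "y > 0"
    note rep = bessel_G_integral_representation[OF \<nu>(1) y]
    define A where "A = 2 powr (- 2 * \<nu>) * Gamma (- \<nu>) * y powr (2 * \<nu>)"
    have "A \<ge> 0" using \<nu> by (simp add: A_def Gamma_real_nonneg)
    have g: "(\<integral>\<^sup>+v. ennreal (indicator {0<..} v * (v powr (\<nu> - 1) * exp (- (y\<^sup>2 / 4) / v))) \<partial>lborel) = ennreal A"
    proof -
      have "(\<integral>\<^sup>+v. ennreal (indicator {0<..} v * (v powr (\<nu> - 1) * exp (- (y\<^sup>2 / 4) / v))) \<partial>lborel)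
        = (\<integral>\<^sup>+v. ennreal (indicator {0<..} v * ((1 / v) powr (\<nu> - 1) * exp (- (y\<^sup>2 / 4) / (1 / v)) / v\<^sup>2)) \<partial>lborel)"
        by (rule nn_integral_inverse_substitution[symmetric]) measurable
      also have "\<dots> = (\<integral>\<^sup>+v. ennreal (indicator {0<..} v * (v powr (- \<nu> - 1) * exp (- (y\<^sup>2 / 4) * v))) \<partial>lborel)"
      proof (rule nn_integral_cong)
        fix v :: real
        have "(1 / v) powr (\<nu> - 1) / v\<^sup>2 = v powr (- \<nu> - 1)" if "v > 0"
        proof -
          have "(1 / v) powr (\<nu> - 1) / v\<^sup>2 = v powr (1 - \<nu>) / v powr 2"
            using that powr_divide[of 1 v "\<nu> - 1"] powr_minus_divide[of v "\<nu> - 1"] by simp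
          also have "\<dots> = v powr (1 - \<nu> - 2)" by (rule powr_diff[symmetric])
          also have "1 - \<nu> - 2 = - \<nu> - 1" by simp
          finally show ?thesis .
        qed
        moreover have "(1 / v) powr (\<nu> - 1) * exp (- (y\<^sup>2 / 4) / (1 / v)) / v\<^sup>2 =
            (1 / v) powr (\<nu> - 1) / v\<^sup>2 * exp (- (y\<^sup>2 / 4) * v)"
          by simp
        ultimately show "ennreal (indicator {0<..} v * ((1 / v) powr (\<nu> - 1) * exp (- (y\<^sup>2 / 4) / (1 / v)) / v\<^sup>2)) =
          ennreal (indicator {0<..} v * (v powr (- \<nu> - 1) * exp (- (y\<^sup>2 / 4) * v)))"
          by (cases "v > 0") (simp_all only: indicator_simps greaterThan_iff mult_zero_left not_False_eq_True)
      qed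
      also have "\<dots> = ennreal (Gamma (- \<nu>) / (y\<^sup>2 / 4) powr (- \<nu>))"
        using \<nu> y by (intro nn_integral_Gamma_scaled) auto
      also have "Gamma (- \<nu>) / (y\<^sup>2 / 4) powr (- \<nu>) = A"
      proof -
        have "(y\<^sup>2 / 4) powr (- \<nu>) = ((y / 2) powr 2) powr (- \<nu>)" using y by (simp add: power_divide)
        also have "\<dots> = (y / 2) powr (- (2 * \<nu>))" by (simp only: powr_powr mult_minus_right)
        also have "\<dots> = y powr (- (2 * \<nu>)) / 2 powr (- 2 * \<nu>)" using y by (simp add: powr_divide)
        finally show ?thesis by (simp add: A_def powr_minus_divide[of y])
      qed
      finally show ?thesis .
    qed
    have up: "2 powr (1 - \<nu>) * bessel_G \<nu> y \<le> A + 0"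
    proof (rule nn_integral_real_le[OF _ _ rep g, where h = "\<lambda>_. 0"])
      fix v :: real assume "v > 0"
      then show "v powr (\<nu> - 1) * exp (- v - y\<^sup>2 / (4 * v)) \<le> v powr (\<nu> - 1) * exp (- (y\<^sup>2 / 4) / v) + 0"
        by (auto intro!: mult_left_mono)
    qed (use \<open>A \<ge> 0\<close> in auto)
    have lo: "A \<le> 2 powr (1 - \<nu>) * bessel_G \<nu> y + enn2real ?D"
    proof (rule nn_integral_real_le[OF _ _ g rep _ D[symmetric]])
      fix v :: real assume v: "v > 0"
      have "- v - y\<^sup>2 / (4 * v) = - v + - (y\<^sup>2 / 4) / v" by simp
      then have "exp (- v - y\<^sup>2 / (4 * v)) = exp (- v) * exp (- (y\<^sup>2 / 4) / v)"
        by (simp only: exp_add)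
      moreover have "(1 - exp (- v)) * exp (- (y\<^sup>2 / 4) / v) \<le> (1 - exp (- v)) * 1"
        using v by (intro mult_left_mono) auto
      ultimately have "exp (- (y\<^sup>2 / 4) / v) \<le> exp (- v - y\<^sup>2 / (4 * v)) + (1 - exp (- v))"
        by (simp add: algebra_simps)
      then have "v powr (\<nu> - 1) * exp (- (y\<^sup>2 / 4) / v) \<le>
          v powr (\<nu> - 1) * (exp (- v - y\<^sup>2 / (4 * v)) + (1 - exp (- v)))"
        by (intro mult_left_mono) auto
      then show "v powr (\<nu> - 1) * exp (- (y\<^sup>2 / 4) / v) \<le> v powr (\<nu> - 1) * exp (- v - y\<^sup>2 / (4 * v))
          + v powr (\<nu> - 1) * (1 - exp (- v))" by (simp only: distrib_left)
    qed (auto simp: bessel_G_nonneg)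
    from up lo show "\<bar>2 powr (1 - \<nu>) * bessel_G \<nu> y - 2 powr (- 2 * \<nu>) * Gamma (- \<nu>) * y powr (2 * \<nu>)\<bar> \<le> enn2real ?D"
      unfolding A_def[symmetric] by (simp add: abs_le_iff)
  qed simp
qed

text \<open>For \<open>\<nu> = 0\<close> the integrand is close to \<open>1 / v\<close> on \<open>[y\<^sup>2, 1]\<close>, and contributes \<open>O(1)\<close> elsewhere.\<close>

lemma bessel_G_near_0_zero:
  assumes y: "0 < y" "y < 1"
  shows "\<bar>2 * bessel_G 0 y + 2 * ln y\<bar> \<le> 5"
proof -
  have rep: "(\<integral>\<^sup>+v. ennreal (indicator {0<..} v * (v powr (0 - 1) * exp (- v - y\<^sup>2 / (4 * v)))) \<partial>lborel)
       = ennreal (2 * bessel_G 0 y)"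
    using bessel_G_integral_representation[of 0 y] y by simp
  have y2: "0 < y\<^sup>2" "y\<^sup>2 < 1" using y by (auto simp: power_less_one_iff)
  have pos: "0 < v" if "y\<^sup>2 \<le> v" for v using that y2 by linarith
  have main: "(\<integral>\<^sup>+v. ennreal (indicator {0<..} v * (indicator {y\<^sup>2..1} v / v)) \<partial>lborel) = ennreal (- 2 * ln y)"
  proof -
    have "(\<integral>\<^sup>+v. ennreal (indicator {0<..} v * (indicator {y\<^sup>2..1} v / v)) \<partial>lborel)
        = (\<integral>\<^sup>+v. ennreal (1 / v) * indicator {y\<^sup>2..1} v \<partial>lborel)"
      using pos by (intro nn_integral_cong) (auto simp: indicator_def)
    also have "\<dots> = ennreal (ln 1 - ln (y\<^sup>2))"
      using y2 by (intro nn_integral_FTC_Icc) (auto intro!: derivative_eq_intros pos less_imp_le[OF pos])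
    finally show ?thesis using y by (simp add: ln_realpow)
  qed
  have exp1: "(\<integral>\<^sup>+v. ennreal (indicator {0<..} v * exp (- v)) \<partial>lborel) = ennreal 1"
  proof -
    have "(\<integral>\<^sup>+v. ennreal (indicator {0<..} v * exp (- v)) \<partial>lborel)
      = (\<integral>\<^sup>+v. ennreal (indicator {0<..} v * (v powr (1 - 1) * exp (- 1 * v))) \<partial>lborel)"
      by (intro nn_integral_cong) (auto simp: indicator_def)
    then show ?thesis using nn_integral_Gamma_scaled[of 1 1] by simp
  qed
  \<comment> \<open>Below \<open>y\<^sup>2\<close> the integrand is at most
    \<open>4 / y\<^sup>2\<close>, contributing 4; above 1 it is at most \<open>exp (- v)\<close>,
    contributing at most 1; in between it is at most \<open>1 / v\<close>. Hence the constant
    5.\<close>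
  have up: "2 * bessel_G 0 y \<le> - 2 * ln y + 5"
  proof (rule nn_integral_real_le[OF _ _ rep main])
    show "(\<integral>\<^sup>+v. ennreal (indicator {0<..} v * (4 / y\<^sup>2 * indicator {0..y\<^sup>2} v + exp (- v))) \<partial>lborel) = ennreal 5"
    proof -
      have "(\<integral>\<^sup>+v. ennreal (indicator {0<..} v * (4 / y\<^sup>2 * indicator {0..y\<^sup>2} v + exp (- v))) \<partial>lborel)
         = (\<integral>\<^sup>+v. ennreal (4 / y\<^sup>2) * indicator {0<..y\<^sup>2} v + ennreal (indicator {0<..} v * exp (- v)) \<partial>lborel)"
        using y2 by (intro nn_integral_cong) (auto simp: indicator_def ennreal_plus[symmetric] simp del: ennreal_plus)
      also have "\<dots> = ennreal (4 / y\<^sup>2) * ennreal (y\<^sup>2) + ennreal 1"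
        using y2 exp1 by (subst nn_integral_add) (auto simp: nn_integral_cmult)
      also have "\<dots> = ennreal 5"
        using y by (simp add: ennreal_mult'[symmetric] ennreal_plus[symmetric] del: ennreal_plus ennreal_1 ennreal_numeral)
      finally show ?thesis .
    qed
    fix v :: real assume v: "v > 0"
    have b1: "v powr (0 - 1) * exp (- v - y\<^sup>2 / (4 * v)) \<le> 4 / y\<^sup>2"
    proof -
      have "y\<^sup>2 / (4 * v) \<le> exp (y\<^sup>2 / (4 * v))"
        using exp_ge_add_one_self[of "y\<^sup>2 / (4 * v)"] by linarith
      also have "\<dots> \<le> exp (v + y\<^sup>2 / (4 * v))" using v by simp
      finally have "exp (- (v + y\<^sup>2 / (4 * v))) \<le> 4 * v / y\<^sup>2"
        unfolding exp_minus using v y by (simp add: field_simps)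
      then have "1 / v * exp (- (v + y\<^sup>2 / (4 * v))) \<le> 1 / v * (4 * v / y\<^sup>2)"
        using v by (intro mult_left_mono) auto
      then show ?thesis using v by (simp add: powr_minus_divide)
    qed
    have b2: "v powr (0 - 1) * exp (- v - y\<^sup>2 / (4 * v)) \<le> 1 / v * 1"
      using v y by (intro mult_mono) (auto simp: powr_minus_divide intro: order_trans[of _ 0])
    have b3: "v powr (0 - 1) * exp (- v - y\<^sup>2 / (4 * v)) \<le> 1 * exp (- v)" if "v \<ge> 1"
      using v y that by (intro mult_mono) (auto simp: powr_minus_divide)
    have n1: "0 \<le> indicator {y\<^sup>2..1} v / v" and n2: "0 \<le> 4 / y\<^sup>2 * indicator {0..y\<^sup>2} v" and n3: "0 \<le> exp (- v)"
      using v by auto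
    consider "v \<le> y\<^sup>2" | "y\<^sup>2 \<le> v" "v \<le> 1" | "1 \<le> v" by linarith
    then show "v powr (0 - 1) * exp (- v - y\<^sup>2 / (4 * v)) \<le>
        indicator {y\<^sup>2..1} v / v + (4 / y\<^sup>2 * indicator {0..y\<^sup>2} v + exp (- v))"
    proof cases
      case 1
      then have "indicator {0..y\<^sup>2} v = (1::real)" using v by simp
      then have "4 / y\<^sup>2 * indicator {0..y\<^sup>2} v = 4 / y\<^sup>2" by simp
      then show ?thesis using b1 n1 n3 by linarith
    next
      case 2
      then have "indicator {y\<^sup>2..1} v = (1::real)" by simp
      then have "indicator {y\<^sup>2..1} v / v = 1 / v" by simp
      then show ?thesis using b2 n2 n3 by linarith
    next
      case 3
      then show ?thesis using b3 n1 n2 by linarith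
    qed
  qed (use y in auto)
  \<comment> \<open>By \<open>1 - x \<le> exp (- x)\<close> at
    \<open>x = v + y\<^sup>2 / (4 * v)\<close>, the integrand falls short of \<open>1 / v\<close> by
    at most \<open>1 + y\<^sup>2 / (4 * v\<^sup>2)\<close>. The first term integrates to 1 over
    [0,1], the second to 1/4 from \<open>y\<^sup>2\<close> to infinity.\<close>
  have lo: "- 2 * ln y \<le> 2 * bessel_G 0 y + (5/4)"
  proof (rule nn_integral_real_le[OF _ _ main rep])
    show "(\<integral>\<^sup>+v. ennreal (indicator {0<..} v * (indicator {0..1} v + y\<^sup>2 / 4 * (indicator {y\<^sup>2..} v * v powr (- 2)))) \<partial>lborel) = ennreal (5/4)"
    proof -
      have "(\<integral>\<^sup>+v. ennreal (indicator {0<..} v * (indicator {0..1} v + y\<^sup>2 / 4 * (indicator {y\<^sup>2..} v * v powr (- 2)))) \<partial>lborel)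
         = (\<integral>\<^sup>+v. indicator {0<..1} v + ennreal (y\<^sup>2 / 4) * (ennreal (v powr (-2)) * indicator {y\<^sup>2..} v) \<partial>lborel)"
        using y2 pos by (intro nn_integral_cong)
          (auto simp: indicator_def ennreal_plus ennreal_mult'[symmetric])
      also have "\<dots> = (\<integral>\<^sup>+v. indicator {0<..1::real} v \<partial>lborel) + ennreal (y\<^sup>2 / 4) * (\<integral>\<^sup>+v. ennreal (v powr (-2)) * indicator {y\<^sup>2..} v \<partial>lborel)"
        by (subst nn_integral_add) (auto simp: nn_integral_cmult)
      also have "(\<integral>\<^sup>+v. ennreal (v powr (-2)) * indicator {y\<^sup>2..} v \<partial>lborel) = ennreal (- ((y\<^sup>2) powr (-2 + 1)) / (-2 + 1))"
        using y2 by (intro nn_integral_has_integral_lebesgue' has_integral_powr_to_inf) auto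
      also have "(\<integral>\<^sup>+v. indicator {0<..1::real} v \<partial>lborel) = ennreal 1" by simp
      also have "ennreal 1 + ennreal (y\<^sup>2 / 4) * ennreal (- ((y\<^sup>2) powr (-2 + 1)) / (-2 + 1)) = ennreal (5/4)"
        using y2 by (simp add: powr_minus_divide ennreal_mult'[symmetric] ennreal_plus[symmetric] del: ennreal_plus ennreal_1 ennreal_numeral)
      finally show ?thesis .
    qed
    fix v :: real assume v: "v > 0"
    have "1 / v \<le> 1 / v * exp (- v - y\<^sup>2 / (4 * v)) + (1 + y\<^sup>2 / 4 * v powr (- 2))"
    proof -
      have "1 + (- v - y\<^sup>2 / (4 * v)) \<le> exp (- v - y\<^sup>2 / (4 * v))" by (rule exp_ge_add_one_self)
      then have "1 / v * (1 + (- v - y\<^sup>2 / (4 * v))) \<le> 1 / v * exp (- v - y\<^sup>2 / (4 * v))"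
        using v by (intro mult_left_mono) auto
      moreover have "1 / v * (1 + (- v - y\<^sup>2 / (4 * v))) = 1 / v - (1 + y\<^sup>2 / 4 * v powr (- 2))"
        using v by (simp add: powr_minus_divide field_simps power2_eq_square)
      ultimately show ?thesis by linarith
    qed
    then show "indicator {y\<^sup>2..1} v / v \<le> v powr (0 - 1) * exp (- v - y\<^sup>2 / (4 * v)) + 
        (indicator {0..1} v + y\<^sup>2 / 4 * (indicator {y\<^sup>2..} v * v powr (- 2)))"
      using v by (cases "y\<^sup>2 \<le> v \<and> v \<le> 1") (auto simp: powr_minus_divide indicator_def)
  qed (use y in \<open>auto simp: bessel_G_nonneg\<close>)
  from up lo show ?thesis by linarith
qed

text \<open>Write the difference as \<open>exp z * (q - m) + (exp z - 1) * m\<close>. For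
  \<open>s \<le> 1\<close>, \<open>exp s \<le> 1 + s + s\<^sup>2 \<le> 1 + 2 * s\<close>, which
  yields the constants 3 and 2. The factor \<open>s\<close> next to \<open>\<bar>m\<bar>\<close> has
  to be kept, as for \<nu> \<le> 0 the model \<open>m\<close> is unbounded when \<open>s\<close>
  tends to 0.\<close>

lemma abs_exp_mult_diff_le:
  fixes z s q m C :: real
  assumes z: "\<bar>z\<bar> \<le> s" "s \<le> 1" and q: "\<bar>q - m\<bar> \<le> C"
  shows "\<bar>exp z * q - m\<bar> \<le> 3 * C + 2 * s * \<bar>m\<bar>"
proof -
  have C: "0 \<le> C" using q by linarith
  have s: "0 \<le> s" using z by linarith
  have "s\<^sup>2 \<le> s" using s z by (simp add: power2_eq_square mult_left_le)
  then have e: "exp s \<le> 1 + 2 * s" using exp_bound[of s] s z by linarith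
  have "exp z \<le> exp s" using z by simp
  then have u: "exp z \<le> 1 + 2 * s" using e by linarith
  have "\<bar>exp z - 1\<bar> \<le> 2 * s"
    unfolding abs_le_iff using u exp_ge_add_one_self[of z] z(1) s by (intro conjI; linarith)
  then have "\<bar>exp z - 1\<bar> * \<bar>m\<bar> \<le> 2 * s * \<bar>m\<bar>" by (intro mult_right_mono) auto
  moreover have "exp z * \<bar>q - m\<bar> \<le> 3 * C" using u z q C by (intro mult_mono) auto
  moreover have "exp z * q - m = exp z * (q - m) + (exp z - 1) * m" by (simp add: algebra_simps)
  ultimately show ?thesis
    using abs_triangle_ineq[of "exp z * (q - m)" "(exp z - 1) * m"] by (simp add: abs_mult)
qed

section \<open>Beta integrals and the three ranges of the order\<close>

lemma has_bochner_integral_Beta: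
  assumes a: "a > (0::real)"
  shows "has_bochner_integral lborel (\<lambda>x. indicator {0<..<1} x * ((1 - x) ^ r * x powr (a - 1))) (Beta a (real r + 1))"
proof (rule has_bochner_integral_nn_integral)
  have "(\<integral>\<^sup>+x. ennreal (indicator {0<..<1} x * ((1 - x) ^ r * x powr (a - 1))) \<partial>lborel) =
    (\<integral>\<^sup>+x. ennreal (x powr (a - 1) * (1 - x) powr (real r + 1 - 1)) * indicator {0..1} x \<partial>lborel)"
    by (intro nn_integral_cong_AE AE_I'[OF finite_imp_null_set_lborel[of "{0, 1}"]])
       (auto simp: indicator_def powr_realpow mult_ac split: if_splits)
  also have "\<dots> = ennreal (Beta a (real r + 1))"
    using a by (intro nn_integral_has_integral_lebesgue' has_integral_Beta_real) auto
  finally show "(\<integral>\<^sup>+x. ennreal (indicator {0<..<1} x * ((1 - x) ^ r * x powr (a - 1))) \<partial>lborel) = ennreal (Beta a (real r + 1))" .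
  show "0 \<le> Beta a (real r + 1)" using a by (simp add: Beta_def Gamma_real_nonneg)
qed (auto simp: indicator_def)

lemma has_bochner_integral_one_minus_power:
  "has_bochner_integral lborel (\<lambda>x::real. indicator {0<..<1} x * ((1 - x) ^ r * c)) (c / (real r + 1))"
proof -
  have np: "real r + 1 \<notin> \<int>\<^sub>\<le>\<^sub>0" by (auto dest!: nonpos_Ints_nonpos)
  have nz: "Gamma (1 + real r) \<noteq> 0"
    by (rule less_imp_neq[symmetric], rule Gamma_real_pos) simp
  have "Beta 1 (real r + 1) = 1 / (real r + 1)"
    using Gamma_plus1[OF np] nz by (simp add: Beta_def add_ac)
  moreover have "(\<lambda>x. indicator {0<..<1} x * ((1 - x) ^ r * x powr (1 - 1))) = (\<lambda>x::real. indicator {0<..<1} x * (1 - x) ^ r)"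
    by (auto simp: indicator_def)
  ultimately have "has_bochner_integral lborel (\<lambda>x::real. indicator {0<..<1} x * (1 - x) ^ r) (1 / (real r + 1))"
    using has_bochner_integral_Beta[of 1 r] by simp
  from has_bochner_integral_mult_left[OF this, of c] show ?thesis by (simp add: mult_ac)
qed

lemma vg_remainder_asymp_pos:
  assumes \<nu>: "\<nu> > 0" and b: "\<bar>b\<bar> < 1"
  shows "(\<lambda>t. vg_remainder \<nu> b r t - Gamma \<nu> / (real r + 1) * \<bar>t\<bar> ^ (r + 1)) \<in> o[at 0](\<lambda>t. \<bar>t\<bar> ^ (r + 1))"
proof -
  \<comment> \<open>Any positive exponent that is at most 1 and strictly below \<nu> would serve;
    halving \<nu> ensures strictness.\<close>
  define \<theta> where "\<theta> = min 1 (\<nu> / 2)"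
  have \<theta>: "0 < \<theta>" "\<theta> \<le> 1" "\<theta> < \<nu>" using \<nu> by (auto simp: \<theta>_def)
  \<comment> \<open>The error bound at \<open>s = \<bar>t\<bar> * x\<close> with \<open>s\<close>
    enlarged to \<open>\<bar>t\<bar>\<close>: uniform in \<open>x\<close> and tending to 0 with
    \<open>t\<close>, which is what a little-o estimate needs.\<close>
  define w where "w = (\<lambda>t. 3 * ((t\<^sup>2 / 4) powr \<theta> * Gamma (\<nu> - \<theta>)) + 2 * \<bar>t\<bar> * Gamma \<nu>)"
  have bound: "\<bar>vg_remainder \<nu> b r t - Gamma \<nu> / (real r + 1) * \<bar>t\<bar> ^ (r + 1)\<bar> \<le> \<bar>t\<bar> ^ (r + 1) * w t"
    if t: "t \<noteq> 0" "\<bar>t\<bar> < 1" for t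
  proof -
    have "\<bar>vg_remainder \<nu> b r t - \<bar>t\<bar> ^ (r + 1) * (\<integral>x. indicator {0<..<1} x * ((1 - x) ^ r * Gamma \<nu>) \<partial>lborel)\<bar>
      \<le> \<bar>t\<bar> ^ (r + 1) * (\<integral>x. indicator {0<..<1::real} x * w t \<partial>lborel)"
    proof (rule vg_remainder_approx[where m = "\<lambda>_. Gamma \<nu>" and w = "\<lambda>_. w t"])
      show "integrable lborel (\<lambda>x::real. indicator {0<..<1} x * ((1 - x) ^ r * Gamma \<nu>))"
        using has_bochner_integral_one_minus_power by (auto simp: has_bochner_integral_iff)
      show "integrable lborel (\<lambda>x::real. indicator {0<..<1} x * w t)" by simp
      fix x :: real assume x: "0 < x" "x < 1"
      define s where "s = \<bar>t\<bar> * x"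
      have s: "0 < s" "s \<le> \<bar>t\<bar>" "s \<le> 1" using t x by (auto simp: s_def mult_le_one mult_left_le)
      have z: "\<bar>- b * t * x\<bar> \<le> s"
        using b x mult_right_mono[of "\<bar>b\<bar>" 1 "\<bar>t\<bar> * x"] by (simp add: abs_mult s_def mult.assoc)
      have main: "\<bar>exp (- b * t * x) * (2 powr (1 - \<nu>) * bessel_G \<nu> s) - Gamma \<nu>\<bar>
        \<le> 3 * ((s\<^sup>2 / 4) powr \<theta> * Gamma (\<nu> - \<theta>)) + 2 * s * \<bar>Gamma \<nu>\<bar>"
        by (rule abs_exp_mult_diff_le[OF z s(3) bessel_G_near_0_pos[OF \<theta> s(1)]])
      have "s\<^sup>2 \<le> t\<^sup>2" using s power_mono[of s "\<bar>t\<bar>" 2] by simp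
      then have 1: "(s\<^sup>2 / 4) powr \<theta> * Gamma (\<nu> - \<theta>) \<le> (t\<^sup>2 / 4) powr \<theta> * Gamma (\<nu> - \<theta>)"
        using \<theta> by (intro mult_right_mono powr_mono2 Gamma_real_nonneg) auto
      have 2: "s * \<bar>Gamma \<nu>\<bar> \<le> \<bar>t\<bar> * Gamma \<nu>"
        using s \<nu> by (intro mult_mono) auto
      show "\<bar>exp (- b * t * x) * (2 powr (1 - \<nu>) * bessel_G \<nu> (\<bar>t\<bar> * x)) - Gamma \<nu>\<bar> \<le> w t"
        unfolding s_def[symmetric] w_def by (rule order_trans[OF main]) (use 1 2 in linarith)
    qed (use \<nu> t in auto)
    moreover have "(\<integral>x. indicator {0<..<1} x * ((1 - x) ^ r * Gamma \<nu>) \<partial>lborel) = Gamma \<nu> / (real r + 1)"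
      by (rule has_bochner_integral_integral_eq[OF has_bochner_integral_one_minus_power])
    moreover have "(\<integral>x. indicator {0<..<1::real} x * w t \<partial>lborel) = w t" by simp
    ultimately show ?thesis by (simp only: mult.commute)
  qed
  have "((\<lambda>t. 3 * ((t\<^sup>2 / 4) powr \<theta> * Gamma (\<nu> - \<theta>)) + 2 * \<bar>t\<bar> * Gamma \<nu>) \<longlongrightarrow>
      3 * ((0\<^sup>2 / 4) powr \<theta> * Gamma (\<nu> - \<theta>)) + 2 * \<bar>0\<bar> * Gamma \<nu>) (at 0)"
    using \<theta> by (intro tendsto_intros tendsto_powr') auto
  then have "(w \<longlongrightarrow> 0) (at 0)" using \<theta> by (simp add: w_def)
  show ?thesis
  proof (rule landau_o.smallI)
    fix c :: real assume c: "c > 0"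
    have "eventually (\<lambda>t. w t < c) (at 0)" using \<open>(w \<longlongrightarrow> 0) (at 0)\<close> c by (rule order_tendstoD)
    moreover have "eventually (\<lambda>t::real. t \<noteq> 0 \<and> \<bar>t\<bar> < 1) (at 0)"
      by (auto simp: eventually_at intro!: exI[of _ 1])
    ultimately show "eventually (\<lambda>t. norm (vg_remainder \<nu> b r t - Gamma \<nu> / (real r + 1) * \<bar>t\<bar> ^ (r + 1))
        \<le> c * norm (\<bar>t\<bar> ^ (r + 1))) (at 0)"
    proof eventually_elim
      case (elim t)
      have "\<bar>t\<bar> ^ (r + 1) * w t \<le> \<bar>t\<bar> ^ (r + 1) * c" using elim by (intro mult_left_mono) auto
      with bound[of t] elim
      have "\<bar>vg_remainder \<nu> b r t - Gamma \<nu> / (real r + 1) * \<bar>t\<bar> ^ (r + 1)\<bar> \<le> \<bar>t\<bar> ^ (r + 1) * c"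
        by linarith
      then show ?case by (simp add: mult.commute)
    qed
  qed
qed

lemma vg_remainder_asymp_zero:
  assumes b: "\<bar>b\<bar> < 1"
  shows "(\<lambda>t. vg_remainder 0 b r t - (- 2 / (real r + 1) * \<bar>t\<bar> ^ (r + 1) * ln \<bar>t\<bar>)) \<in> O[at 0](\<lambda>t. \<bar>t\<bar> ^ (r + 1))"
proof -
  \<comment> \<open>Here \<open>19 = 3 * 5 + 4\<close>: 5 is the error of
    \<open>bessel_G_near_0_zero\<close>, and 4 bounds \<open>2 * s * \<bar>2 * ln s\<bar>\<close>
    because \<open>s * (- ln s) \<le> 1\<close>. The model keeps only
    \<open>- 2 * ln \<bar>t\<bar>\<close> out of \<open>- 2 * ln (\<bar>t\<bar> * x)\<close>; the
    discarded \<open>- 2 * ln x\<close> is at most \<open>4 * x powr (- 1/2)\<close>, an integrable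
    function, written so as to match a Beta integral.\<close>
  define w where "w = (\<lambda>x::real. 19 + 4 * x powr (1/2 - 1))"
  have w: "integrable lborel (\<lambda>x. indicator {0<..<1} x * w x)"
  proof -
    have "integrable lborel (\<lambda>x::real. indicator {0<..<1} x * 19 + 4 * (indicator {0<..<1} x * ((1 - x) ^ 0 * x powr (1/2 - 1))))"
      using has_bochner_integral_Beta[of "1/2" 0]
      by (intro Bochner_Integration.integrable_add integrable_mult_right) (auto simp: has_bochner_integral_iff)
    then show ?thesis by (simp add: w_def algebra_simps)
  qed
  have bound: "\<bar>vg_remainder 0 b r t - (- 2 / (real r + 1) * \<bar>t\<bar> ^ (r + 1) * ln \<bar>t\<bar>)\<bar>
      \<le> (\<integral>x. indicator {0<..<1} x * w x \<partial>lborel) * \<bar>t\<bar> ^ (r + 1)" if t: "t \<noteq> 0" "\<bar>t\<bar> < 1" for t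
  proof -
    have "\<bar>vg_remainder 0 b r t - \<bar>t\<bar> ^ (r + 1) * (\<integral>x. indicator {0<..<1} x * ((1 - x) ^ r * (- 2 * ln \<bar>t\<bar>)) \<partial>lborel)\<bar>
      \<le> \<bar>t\<bar> ^ (r + 1) * (\<integral>x. indicator {0<..<1} x * w x \<partial>lborel)"
    proof (rule vg_remainder_approx[where m = "\<lambda>_. - 2 * ln \<bar>t\<bar>" and w = w])
      show "integrable lborel (\<lambda>x::real. indicator {0<..<1} x * ((1 - x) ^ r * (- 2 * ln \<bar>t\<bar>)))"
        using has_bochner_integral_one_minus_power by (auto simp: has_bochner_integral_iff)
      fix x :: real assume x: "0 < x" "x < 1"
      define s where "s = \<bar>t\<bar> * x"
      have s: "0 < s" "s < 1" "s \<le> 1" using t x mult_strict_mono[of "\<bar>t\<bar>" 1 x 1] by (auto simp: s_def)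
      have z: "\<bar>- b * t * x\<bar> \<le> s"
        using b x mult_right_mono[of "\<bar>b\<bar>" 1 "\<bar>t\<bar> * x"] by (simp add: abs_mult s_def mult.assoc)
      have q: "\<bar>2 * bessel_G 0 s - (- 2 * ln s)\<bar> \<le> 5" using bessel_G_near_0_zero[OF s(1,2)] by simp
      have 1: "\<bar>exp (- b * t * x) * (2 * bessel_G 0 s) - (- 2 * ln s)\<bar> \<le> 3 * 5 + 2 * s * \<bar>- 2 * ln s\<bar>"
        by (rule abs_exp_mult_diff_le[OF z s(3) q])
      have "- ln s \<le> 1 / s - 1" using ln_le_minus_one[of "1 / s"] s by (simp add: ln_div)
      then have "s * (- ln s) \<le> s * (1 / s - 1)" using s by (intro mult_left_mono) auto
      also have "\<dots> \<le> 1" using s by (simp add: algebra_simps)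
      finally have 2: "2 * s * \<bar>- 2 * ln s\<bar> \<le> 4" using s by (simp add: abs_mult)
      have "- (1 / 2) * ln x = ln (x powr (- (1 / 2)))" using x by (simp add: ln_powr)
      also have "\<dots> \<le> x powr (- (1 / 2))" using x ln_le_minus_one[of "x powr (- (1 / 2))"] by simp
      finally have 3: "- 2 * ln x \<le> 4 * x powr (1 / 2 - 1)" by simp
      have 4: "ln s = ln \<bar>t\<bar> + ln x" using t x by (simp add: s_def ln_mult)
      have 5: "ln x < 0" using x by simp
      have arith: "\<bar>A - (- 2 * (p + q))\<bar> \<le> 3 * 5 + 4 \<Longrightarrow> - 2 * q \<le> 4 * y \<Longrightarrow> q < 0 \<Longrightarrow>
          \<bar>A - (- 2 * p)\<bar> \<le> 19 + 4 * y" for A p q y :: real unfolding abs_le_iff by auto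
      have "\<bar>exp (- b * t * x) * (2 * bessel_G 0 s) - (- 2 * ln \<bar>t\<bar>)\<bar> \<le> w x"
        using arith[OF order_trans[OF 1 add_left_mono[OF 2], unfolded 4] 3 5] unfolding w_def .
      then show "\<bar>exp (- b * t * x) * (2 powr (1 - 0) * bessel_G 0 (\<bar>t\<bar> * x)) - (- 2 * ln \<bar>t\<bar>)\<bar> \<le> w x"
        by (simp add: s_def)
    qed (use t w in auto)
    moreover have "(\<integral>x. indicator {0<..<1} x * ((1 - x) ^ r * (- 2 * ln \<bar>t\<bar>)) \<partial>lborel) = - 2 * ln \<bar>t\<bar> / (real r + 1)"
      by (rule has_bochner_integral_integral_eq[OF has_bochner_integral_one_minus_power])
    moreover have "\<bar>t\<bar> ^ (r + 1) * (- 2 * ln \<bar>t\<bar> / (real r + 1)) = - 2 / (real r + 1) * \<bar>t\<bar> ^ (r + 1) * ln \<bar>t\<bar>"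
      by simp
    ultimately show ?thesis by (simp only: mult.commute[of "\<bar>t\<bar> ^ (r + 1)" "integral\<^sup>L _ _"])
  qed
  show ?thesis
  proof (rule bigoI)
    have "eventually (\<lambda>t::real. t \<noteq> 0 \<and> \<bar>t\<bar> < 1) (at 0)"
      by (auto simp: eventually_at intro!: exI[of _ 1])
    then show "eventually (\<lambda>t. norm (vg_remainder 0 b r t - (- 2 / (real r + 1) * \<bar>t\<bar> ^ (r + 1) * ln \<bar>t\<bar>))
        \<le> (\<integral>x. indicator {0<..<1} x * w x \<partial>lborel) * norm (\<bar>t\<bar> ^ (r + 1))) (at 0)"
      by eventually_elim (use bound in simp)
  qed
qed

lemma vg_remainder_asymp_neg:
  assumes \<nu>: "-1/2 < \<nu>" "\<nu> < 0" and b: "\<bar>b\<bar> < 1"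
  shows "(\<lambda>t. vg_remainder \<nu> b r t - 2 powr (- 2 * \<nu>) * Gamma (- \<nu>) * Beta (real r + 1) (2 * \<nu> + 1) *
             \<bar>t\<bar> powr (real r + 1 + 2 * \<nu>)) \<in> O[at 0](\<lambda>t. \<bar>t\<bar> ^ (r + 1))"
proof -
  define \<kappa> where "\<kappa> = 2 powr (- 2 * \<nu>) * Gamma (- \<nu>)"
  have \<kappa>: "\<kappa> \<ge> 0" using \<nu> by (simp add: \<kappa>_def Gamma_real_nonneg)
  have "\<exists>C\<ge>0. \<forall>y>0. \<bar>2 powr (1 - \<nu>) * bessel_G \<nu> y - \<kappa> * y powr (2 * \<nu>)\<bar> \<le> C"
    unfolding \<kappa>_def by (rule bessel_G_near_0_neg) (use \<nu> in auto)
  then obtain C where C: "C \<ge> 0" "\<And>y. y > 0 \<Longrightarrow> \<bar>2 powr (1 - \<nu>) * bessel_G \<nu> y - \<kappa> * y powr (2 * \<nu>)\<bar> \<le> C"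
    by blast
  define B where "B = Beta (real r + 1) (2 * \<nu> + 1)"
  have Beta: "has_bochner_integral lborel (\<lambda>x. indicator {0<..<1} x * ((1 - x) ^ r * x powr (2 * \<nu>))) B"
    using has_bochner_integral_Beta[of "2 * \<nu> + 1" r] \<nu> by (simp add: B_def Beta_commute)
  have bound: "\<bar>vg_remainder \<nu> b r t - \<kappa> * B * \<bar>t\<bar> powr (real r + 1 + 2 * \<nu>)\<bar>
      \<le> (3 * C + 2 * \<kappa>) * \<bar>t\<bar> ^ (r + 1)" if t: "t \<noteq> 0" "\<bar>t\<bar> < 1" for t
  proof -
    \<comment> \<open>The leading term of G at \<open>\<bar>t\<bar> * x\<close>, split so that its
      integral against \<open>(1 - x) ^ r\<close> is a Beta value.\<close>
    define m where "m = (\<lambda>x. \<kappa> * \<bar>t\<bar> powr (2 * \<nu>) * x powr (2 * \<nu>))"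
    have m: "has_bochner_integral lborel (\<lambda>x. indicator {0<..<1} x * ((1 - x) ^ r * m x)) (\<kappa> * \<bar>t\<bar> powr (2 * \<nu>) * B)"
      using has_bochner_integral_mult_right[OF Beta, of "\<kappa> * \<bar>t\<bar> powr (2 * \<nu>)"] by (simp add: m_def mult_ac)
    have "\<bar>vg_remainder \<nu> b r t - \<bar>t\<bar> ^ (r + 1) * (\<integral>x. indicator {0<..<1} x * ((1 - x) ^ r * m x) \<partial>lborel)\<bar>
      \<le> \<bar>t\<bar> ^ (r + 1) * (\<integral>x. indicator {0<..<1::real} x * (3 * C + 2 * \<kappa>) \<partial>lborel)"
    proof (rule vg_remainder_approx[where m = m and w = "\<lambda>_. 3 * C + 2 * \<kappa>"])
      show "integrable lborel (\<lambda>x. indicator {0<..<1} x * ((1 - x) ^ r * m x))"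
        using m by (simp add: has_bochner_integral_iff)
      show "integrable lborel (\<lambda>x::real. indicator {0<..<1} x * (3 * C + 2 * \<kappa>))" by simp
      fix x :: real assume x: "0 < x" "x < 1"
      define s where "s = \<bar>t\<bar> * x"
      have s: "0 < s" "s < 1" "s \<le> 1" using t x mult_strict_mono[of "\<bar>t\<bar>" 1 x 1] by (auto simp: s_def)
      have z: "\<bar>- b * t * x\<bar> \<le> s"
        using b x mult_right_mono[of "\<bar>b\<bar>" 1 "\<bar>t\<bar> * x"] by (simp add: abs_mult s_def mult.assoc)
      have mx: "m x = \<kappa> * s powr (2 * \<nu>)" using t x by (simp add: m_def s_def powr_mult)
      have "\<bar>exp (- b * t * x) * (2 powr (1 - \<nu>) * bessel_G \<nu> s) - m x\<bar> \<le> 3 * C + 2 * s * \<bar>m x\<bar>"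
        unfolding mx by (rule abs_exp_mult_diff_le[OF z s(3) C(2)[OF s(1)]])
      \<comment> \<open>The error caused by the exponential factor is bounded because
        \<open>1 + 2 * \<nu> > 0\<close>: its factor \<open>s\<close> outweighs the singularity
        \<open>s powr (2 * \<nu>)\<close> of the model.\<close>
      also have "s * \<bar>m x\<bar> = \<kappa> * s powr (1 + 2 * \<nu>)"
        using s \<kappa> unfolding mx by (simp add: powr_add abs_mult)
      then have "2 * s * \<bar>m x\<bar> = 2 * (\<kappa> * s powr (1 + 2 * \<nu>))" by simp
      also have "\<kappa> * s powr (1 + 2 * \<nu>) \<le> \<kappa> * 1"
        using s \<nu> \<kappa> by (intro mult_left_mono powr_le1) auto
      finally show "\<bar>exp (- b * t * x) * (2 powr (1 - \<nu>) * bessel_G \<nu> (\<bar>t\<bar> * x)) - m x\<bar> \<le> 3 * C + 2 * \<kappa>"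
        by (simp add: s_def)
    qed (use \<nu> t in auto)
    moreover have "\<bar>t\<bar> ^ (r + 1) * (\<kappa> * \<bar>t\<bar> powr (2 * \<nu>) * B) = \<kappa> * B * \<bar>t\<bar> powr (real r + 1 + 2 * \<nu>)"
    proof -
      have "\<bar>t\<bar> ^ (r + 1) = \<bar>t\<bar> powr (real r + 1)" using t powr_realpow[of "\<bar>t\<bar>" "r + 1"] by (simp add: add.commute)
      then show ?thesis by (simp only: powr_add[of _ "real r + 1"]) simp
    qed
    moreover have "(\<integral>x. indicator {0<..<1::real} x * (3 * C + 2 * \<kappa>) \<partial>lborel) = 3 * C + 2 * \<kappa>" by simp
    ultimately show ?thesis
      unfolding has_bochner_integral_integral_eq[OF m] by (simp only: mult.commute)
  qed
  show ?thesis
    unfolding \<kappa>_def[symmetric] B_def[symmetric]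
  proof (rule bigoI)
    have "eventually (\<lambda>t::real. t \<noteq> 0 \<and> \<bar>t\<bar> < 1) (at 0)"
      by (auto simp: eventually_at intro!: exI[of _ 1])
    then show "eventually (\<lambda>t. norm (vg_remainder \<nu> b r t - \<kappa> * B * \<bar>t\<bar> powr (real r + 1 + 2 * \<nu>))
        \<le> (3 * C + 2 * \<kappa>) * norm (\<bar>t\<bar> ^ (r + 1))) (at 0)"
      by eventually_elim (use bound in simp)
  qed
qed

text \<open>A single \<open>R\<close> has to serve all \<mu>, for otherwise its behaviour at 0 would
  constrain nothing. Therefore a random variable \<open>X \<mu>\<close> on a probability space
  \<open>M \<mu>\<close> is given for every \<mu>, with the other parameters fixed, and
  \<open>R\<close> is quantified first. The filter \<open>at 0\<close> covers both signs of
  \<mu>.\<close>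

theorem proposition2p8:
  fixes \<nu> \<alpha> \<beta> :: real and r :: nat
    and M :: "real \<Rightarrow> 'a measure" and X :: "real \<Rightarrow> 'a \<Rightarrow> real"
  assumes "\<nu> > -1/2" and "0 \<le> \<bar>\<beta>\<bar>" and "\<bar>\<beta>\<bar> < \<alpha>"
    and "r \<ge> 1" and "odd r"
    and "\<And>\<mu>. prob_space (M \<mu>)"
    and "\<And>\<mu>. distributed (M \<mu>) lborel (X \<mu>) (\<lambda>x. ennreal (vg_density \<nu> \<alpha> \<beta> \<mu> x))"
  shows "\<exists>R :: real \<Rightarrow> real.
    (\<forall>\<mu>. integrable (M \<mu>) (\<lambda>\<omega>. \<bar>X \<mu> \<omega>\<bar> ^ r) \<and>
      prob_space.expectation (M \<mu>) (\<lambda>\<omega>. \<bar>X \<mu> \<omega>\<bar> ^ r) =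
        2 ^ r * (1 - \<beta>\<^sup>2 / \<alpha>\<^sup>2) powr (\<nu> + 1/2) / (sqrt pi * \<alpha> ^ r * Gamma (\<nu> + 1/2)) *
        ((\<Sum>k = 0..(r - 1) div 2.
            (\<alpha> * \<mu> / 2) ^ (2 * k) *
            Gamma ((real r - 2 * real k + 1) / 2) *
            Gamma (\<nu> + (real r - 2 * real k + 1) / 2) *
            (real (r choose (2 * k)) *
               hyp2F1 ((real r - 2 * real k + 1) / 2) (\<nu> + (real r - 2 * real k + 1) / 2)
                 (1/2) (\<beta>\<^sup>2 / \<alpha>\<^sup>2)
             + \<beta> / \<alpha> * (\<alpha> * \<mu>) * real (r choose (2 * k + 1)) *
               hyp2F1 ((real r - 2 * real k + 1) / 2) (\<nu> + (real r - 2 * real k + 1) / 2)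
                 (3/2) (\<beta>\<^sup>2 / \<alpha>\<^sup>2)))
         + R (\<alpha> * \<mu>) / 2 ^ r)) \<and>
    (\<nu> > 0 \<longrightarrow>
      (\<lambda>t. R t - Gamma \<nu> / (real r + 1) * \<bar>t\<bar> ^ (r + 1))
        \<in> o[at 0](\<lambda>t. \<bar>t\<bar> ^ (r + 1))) \<and>
    (\<nu> = 0 \<longrightarrow>
      (\<lambda>t. R t - (- 2 / (real r + 1) * \<bar>t\<bar> ^ (r + 1) * ln \<bar>t\<bar>))
        \<in> O[at 0](\<lambda>t. \<bar>t\<bar> ^ (r + 1))) \<and>
    (-1/2 < \<nu> \<and> \<nu> < 0 \<longrightarrow>
      (\<lambda>t. R t - 2 powr (- 2 * \<nu>) * Gamma (- \<nu>) * Beta (real r + 1) (2 * \<nu> + 1) *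
             \<bar>t\<bar> powr (real r + 1 + 2 * \<nu>))
        \<in> O[at 0](\<lambda>t. \<bar>t\<bar> ^ (r + 1)))"
proof -
  obtain p where p: "r = 2 * p + 1" using \<open>odd r\<close> by (rule oddE)
  then have p': "(r - 1) div 2 = p" by simp
  have b: "\<bar>\<beta> / \<alpha>\<bar> < 1" using assms(3) by (simp add: field_simps)
  note moment = vg_absolute_moment[OF assms(1,3) p assms(6,7)]
  show ?thesis
    unfolding p'
  proof (rule exI[of _ "vg_remainder \<nu> (\<beta> / \<alpha>) r"], intro conjI allI impI)
    assume "\<nu> > 0"
    then show "(\<lambda>t. vg_remainder \<nu> (\<beta> / \<alpha>) r t - Gamma \<nu> / (real r + 1) * \<bar>t\<bar> ^ (r + 1))
        \<in> o[at 0](\<lambda>t. \<bar>t\<bar> ^ (r + 1))"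
      by (rule vg_remainder_asymp_pos[OF _ b])
  next
    assume "\<nu> = 0"
    with vg_remainder_asymp_zero[OF b]
    show "(\<lambda>t. vg_remainder \<nu> (\<beta> / \<alpha>) r t - (- 2 / (real r + 1) * \<bar>t\<bar> ^ (r + 1) * ln \<bar>t\<bar>))
        \<in> O[at 0](\<lambda>t. \<bar>t\<bar> ^ (r + 1))" by (simp only:)
  next
    assume "- 1 / 2 < \<nu> \<and> \<nu> < 0"
    then show "(\<lambda>t. vg_remainder \<nu> (\<beta> / \<alpha>) r t - 2 powr (- 2 * \<nu>) * Gamma (- \<nu>) *
          Beta (real r + 1) (2 * \<nu> + 1) * \<bar>t\<bar> powr (real r + 1 + 2 * \<nu>))
        \<in> O[at 0](\<lambda>t. \<bar>t\<bar> ^ (r + 1))"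
      by (intro vg_remainder_asymp_neg b) simp_all
  qed (rule moment)+
qed

end
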